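(* Let $\mathcal{M}$ be $\{0,1\}^n$ with the Hamming metric. Let $(\mathsf{SS},\mathsf{SRec})$ be a deterministic linear $(m,m-k,t)$-secure sketch of output length $k$ for $\mathcal{M}$, such that $\mathsf{SS}(w)=\mathsf{S}w$ for a $k\times n$ binary matrix $\mathsf{S}$ of rank $k$ (so $\mathsf{SS}$ is surjective). Let $\mathsf{S}^\perp$ be an $(n-k)\times n$ matrix such that the $n\times n$ matrix obtained by stacking $\mathsf{S}$ on top of $\mathsf{S}^\perp$ has full rank, and put $\mathsf{SS}^\perp(w)=\mathsf{S}^\perp w$. Let $n'=n-k$, assumed even, and let $L=2\lceil k/n'\rceil$. For $s\in\{0,1\}^k$, pad $s$ with zeros to length $Ln'/2$ and split it as $s_{L-1}\|\cdots\|s_0$, with each $s_j\in\mathbb{F}_{2^{n'/2}}$. For $i\in\mathbb{F}_{2^{n'/2}}$ define $$f_{s,i}(x)=x^{L+3}+x^2\bigl(s_{L-1}x^{L-1}+\cdots+s_1x+s_0\bigr)+ix.$$ Let $B$ be the number of points in a Hamming ball of radius $t$ in $\{0,1\}^n$. Let $m,\ell,t,\varepsilon,\delta$ satisfy $$\ell\le m-\frac n2-k-\log B-\log\left(2\left\lceil\frac{k}{n-k}\right\rceil+2\right)-\log\frac1\delta$$ and $$m\ge\frac12(n+k)+2\log\frac1\varepsilon,$$ and set $v=(n-k)/2-\ell$. Define the procedures: $\mathsf{Gen}(w)$: 1. Set $s=\mathsf{SS}(w)$ and $c=\mathsf{SS}^\perp(w)$. 2. Let $a=[c]_1^{n'/2}$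 and $b=[c]_{n'/2+1}^{n'}$, viewed as elements of $\mathbb{F}_{2^{n'/2}}$. 3. Choose $i$ uniformly from $\mathbb{F}_{2^{n'/2}}$. 4. Output $R=[f_{s,i}(a)+b]_{v+1}^{n'/2}$ and $P=(s,i,\sigma)$, where $\sigma=[f_{s,i}(a)+b]_1^{v}$. $\mathsf{Rep}(w',P'=(s',i',\sigma'))$: 1. Compute $w^*=\mathsf{SRec}(w',s')$. If $\mathrm{dis}(w^*,w')>t$ or $\mathsf{SS}(w^* )\neq s'$, output $\perp$. 2. Let $c'=\mathsf{SS}^\perp(w^* )=a'\|b'$, split into halves. 3. If $\sigma'=[f_{s',i'}(a')+b']_1^{v}$, output $[f_{s',i'}(a')+b']_{v+1}^{n'/2}$; otherwise output $\perp$. Then $(\mathsf{Gen},\mathsf{Rep})$ is an $(m,\ell,t,\varepsilon)$-fuzzy extractor with post-application robustness $\delta$.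
   Context: Notation and conventions. - For a bit string $x$, $[x]_i^j$ denotes $x_i\cdots x_j$. - Elements of $\mathbb{F}_{2^{n'/2}}$ are identified with $n'/2$-bit strings through a fixed representation in which field addition is bitwise XOR. - All logarithms are base 2. - $\mathrm{dis}$ is the Hamming distance. - $U_\ell$ is the uniform distribution on $\{0,1\}^\ell$. - $\mathbf{SD}(X_1,X_2)=\frac12\sum_s|\Pr[X_1=s]-\Pr[X_2=s]|$ is statistical distance. - $\mathbf{H}_\infty(W)=-\log\max_w\Pr[W=w]$ is min-entropy. - The average conditional min-entropy is $\widetilde{\mathbf{H}}_\infty(W\mid E)=-\log\mathbb{E}_{e\leftarrow E}\bigl[2^{-\mathbf{H}_\infty(W\mid E=e)}\bigr]$. Secure sketch. An $(m,\tilde m,t)$-secure sketch is a pair of procedures $(\mathsf{SS},\mathsf{SRec})$ with: - Correctness: if $\mathrm{dis}(w,w')\le t$, then $\mathsf{SRec}(w',\mathsf{SS}(w))=w$. - Security: if $\mathbf{H}_\infty(W)\ge m$, then $\widetilde{\mathbf{H}}_\infty(W\mid\mathsf{SS}(W))\ge\tilde m$. Fuzzy extractor. An $(m,\ell,t,\varepsilon)$-fuzzy extractor is a pair $(\mathsf{Gen},\mathsf{Rep})$ such that: - $\mathsf{Gen}(w)$ outputs $R\in\{0,1\}^\ell$ and a helper string $P$. - Correctness: if $\mathrm{dis}(w,w')\le t$ and $(R,P)\leftarrow\mathsf{Gen}(w)$, then $\mathsf{Rep}(w',P)=R$. - Security: for every $W$ with $\mathbf{H}_\infty(W)\ge m$,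 $\mathbf{SD}((R,P),U_\ell\times P)\le\varepsilon$. Robustness. - A $(t,m)$-pair is a pair $(W,W')$ with $\mathrm{dis}(W,W')\le t$ with probability one and $\mathbf{H}_\infty(W)\ge m$. - Post-application robustness $\delta$ means the following, for every $(t,m)$-pair and every unbounded adversary $A$. Sample $(w,w')$, let $(R,P)=\mathsf{Gen}(w)$, and let $\tilde P=A(R,P)$. The probability that $\tilde P\ne P$ and $\mathsf{Rep}(w',\tilde P)\ne\perp$ is at most $\delta$. *)

theory Defs
  imports "HOL-Probability.Probability_Mass_Function" "HOL-Library.Z2"
    "Jordan_Normal_Form.DL_Rank"
begin

(* Bit strings of length l are the vectors in carrier_vec l over GF(2) = bit.
   Indices: position j (1-indexed in the paper) is component (j-1). *)
type_synonym bits = "bit vec"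

(* [x]_i^j (1-indexed, inclusive): a string of length j - i + 1 *)
definition substr :: "bits \<Rightarrow> nat \<Rightarrow> nat \<Rightarrow> bits" where
  "substr x i j = vec (Suc j - i) (\<lambda>t. x $ (i - 1 + t))"

definition dis :: "bits \<Rightarrow> bits \<Rightarrow> nat" where
  "dis x y = card {j. j < dim_vec x \<and> x $ j \<noteq> y $ j}"

definition ball_size :: "nat \<Rightarrow> nat \<Rightarrow> nat" where
  "ball_size n t = card {y \<in> carrier_vec n. dis (0\<^sub>v n) y \<le> t}"

definition unif :: "nat \<Rightarrow> bits pmf" where
  "unif l = pmf_of_set (carrier_vec l)"

definition stat_dist :: "'a pmf \<Rightarrow> 'a pmf \<Rightarrow> real" where
  "stat_dist X Y = (\<Sum>\<^sub>\<infinity>s. \<bar>pmf X s - pmf Y s\<bar>) / 2"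

definition min_entropy :: "'a pmf \<Rightarrow> real" where
  "min_entropy W = - log 2 (SUP w. pmf W w)"

definition avg_cond_min_entropy :: "('a \<times> 'b) pmf \<Rightarrow> real" where
  "avg_cond_min_entropy J =
     - log 2 (measure_pmf.expectation (map_pmf snd J)
        (\<lambda>e. 2 powr (- min_entropy (map_pmf fst (cond_pmf J {p. snd p = e})))))"

definition secure_sketch ::
  "nat \<Rightarrow> (bits \<Rightarrow> 'b) \<Rightarrow> (bits \<Rightarrow> 'b \<Rightarrow> bits) \<Rightarrow> real \<Rightarrow> real \<Rightarrow> nat \<Rightarrow> bool" where
  "secure_sketch n SS SRec m m' t \<longleftrightarrow>
     (\<forall>w\<in>carrier_vec n. \<forall>w'\<in>carrier_vec n. dis w w' \<le> t \<longrightarrow> SRec w' (SS w) = w) \<and>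
     (\<forall>W. set_pmf W \<subseteq> carrier_vec n \<longrightarrow> min_entropy W \<ge> m \<longrightarrow>
          avg_cond_min_entropy (map_pmf (\<lambda>w. (w, SS w)) W) \<ge> m')"

definition fuzzy_extractor ::
  "nat \<Rightarrow> (bits \<Rightarrow> (bits \<times> 'p) pmf) \<Rightarrow> (bits \<Rightarrow> 'p \<Rightarrow> bits option)
     \<Rightarrow> real \<Rightarrow> nat \<Rightarrow> nat \<Rightarrow> real \<Rightarrow> bool" where
  "fuzzy_extractor n Gen Rep m l t eps \<longleftrightarrow>
     (\<forall>w\<in>carrier_vec n. \<forall>(R, P)\<in>set_pmf (Gen w). R \<in> carrier_vec l) \<and>
     (\<forall>w\<in>carrier_vec n. \<forall>w'\<in>carrier_vec n. dis w w' \<le> t \<longrightarrow>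
        (\<forall>(R, P)\<in>set_pmf (Gen w). Rep w' P = Some R)) \<and>
     (\<forall>W. set_pmf W \<subseteq> carrier_vec n \<longrightarrow> min_entropy W \<ge> m \<longrightarrow>
        stat_dist (bind_pmf W Gen) (pair_pmf (unif l) (map_pmf snd (bind_pmf W Gen))) \<le> eps)"

definition tm_pair :: "nat \<Rightarrow> nat \<Rightarrow> real \<Rightarrow> (bits \<times> bits) pmf \<Rightarrow> bool" where
  "tm_pair n t m WW \<longleftrightarrow>
     set_pmf WW \<subseteq> carrier_vec n \<times> carrier_vec n \<and>
     (\<forall>(w, w')\<in>set_pmf WW. dis w w' \<le> t) \<and>
     min_entropy (map_pmf fst WW) \<ge> m"

(* post-application robustness delta; the adversary A is an arbitrary
   (unbounded, possibly randomized) map from (R,P) to a distribution on helper strings *)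
definition post_app_robust ::
  "nat \<Rightarrow> (bits \<Rightarrow> (bits \<times> 'p) pmf) \<Rightarrow> (bits \<Rightarrow> 'p \<Rightarrow> bits option)
     \<Rightarrow> nat \<Rightarrow> real \<Rightarrow> real \<Rightarrow> bool" where
  "post_app_robust n Gen Rep t m \<delta> \<longleftrightarrow>
     (\<forall>WW (A :: bits \<Rightarrow> 'p \<Rightarrow> 'p pmf). tm_pair n t m WW \<longrightarrow>
        measure_pmf.prob
          (bind_pmf WW (\<lambda>(w, w'). bind_pmf (Gen w) (\<lambda>(R, P).
             bind_pmf (A R P) (\<lambda>P'. return_pmf (P, P', w')))))
          {(P, P', w'). P' \<noteq> P \<and> Rep w' P' \<noteq> None} \<le> \<delta>)"

(* elements of F_{2^h} are identified with h-bit strings via the bijection rep;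
   fromrep is its inverse *)
definition fromrep :: "('f \<Rightarrow> bits) \<Rightarrow> bits \<Rightarrow> 'f" where
  "fromrep rep x = inv_into UNIV rep x"

definition pad :: "nat \<Rightarrow> bits \<Rightarrow> bits" where
  "pad len s = vec len (\<lambda>j. if j < dim_vec s then s $ j else 0)"

(* s_j, where pad (L*h) s = s_{L-1} || ... || s_0 *)
definition coeff_s :: "('f \<Rightarrow> bits) \<Rightarrow> nat \<Rightarrow> nat \<Rightarrow> bits \<Rightarrow> nat \<Rightarrow> 'f" where
  "coeff_s rep h L s j = fromrep rep (substr (pad (L * h) s) ((L - 1 - j) * h + 1) ((L - j) * h))"

definition fpoly :: "('f::field \<Rightarrow> bits) \<Rightarrow> nat \<Rightarrow> nat \<Rightarrow> bits \<Rightarrow> 'f \<Rightarrow> 'f \<Rightarrow> 'f" where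
  "fpoly rep h L s i x = x ^ (L + 3) + x ^ 2 * (\<Sum>j<L. coeff_s rep h L s j * x ^ j) + i * x"

definition Lpar :: "nat \<Rightarrow> nat \<Rightarrow> nat" where
  "Lpar n k = 2 * nat \<lceil>real k / real (n - k)\<rceil>"

definition Gen_c ::
  "nat \<Rightarrow> nat \<Rightarrow> bit mat \<Rightarrow> bit mat \<Rightarrow> ('f::field \<Rightarrow> bits) \<Rightarrow> nat \<Rightarrow> bits
     \<Rightarrow> (bits \<times> (bits \<times> 'f \<times> bits)) pmf" where
  "Gen_c n k S Sp rep l w =
     (let n' = n - k; h = n' div 2; L = Lpar n k; v = h - l;
          s = S *\<^sub>v w; c = Sp *\<^sub>v w;
          a = fromrep rep (substr c 1 h); b = fromrep rep (substr c (h + 1) n')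
      in map_pmf (\<lambda>i. let y = rep (fpoly rep h L s i a + b)
                       in (substr y (v + 1) h, (s, i, substr y 1 v)))
           (pmf_of_set UNIV))"

definition Rep_c ::
  "nat \<Rightarrow> nat \<Rightarrow> bit mat \<Rightarrow> bit mat \<Rightarrow> (bits \<Rightarrow> bits \<Rightarrow> bits) \<Rightarrow> ('f::field \<Rightarrow> bits)
     \<Rightarrow> nat \<Rightarrow> nat \<Rightarrow> bits \<Rightarrow> (bits \<times> 'f \<times> bits) \<Rightarrow> bits option" where
  "Rep_c n k S Sp SRec rep l t w' P' =
     (case P' of (s', i', \<sigma>') \<Rightarrow>
       if s' \<notin> carrier_vec k then None else
       (let n' = n - k; h = n' div 2; L = Lpar n k; v = h - l;
            ws = SRec w' s'
        in if dis ws w' > t \<or> S *\<^sub>v ws \<noteq> s' then None else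
           (let c' = Sp *\<^sub>v ws;
                a' = fromrep rep (substr c' 1 h); b' = fromrep rep (substr c' (h + 1) n');
                y = rep (fpoly rep h L s' i' a' + b')
            in if \<sigma>' = substr y 1 v then Some (substr y (v + 1) h) else None)))"

end

(*
  Security. Given the syndrome, i ranges over a universal family of hash functions in w = (a, b), since
  a collision of distinct strings forces a linear equation in i with nonzero slope. A leftover hash
  argument bounds the distance of the whole hash value from uniform by half of sqrt (2^(k + n'/2 - m)),
  and publishing the part sigma of it costs a factor of two.

  Robustness. The syndrome S w and the forged syndrome s' determine, together with w + w', the
  difference of w and the string w* that Rep recovers. The adversary sees the full hash
  y = f_{s,i}(a) + b, so b is a function of a, and a forgery succeeds only if
  f_{s',i'}(a + alpha) - f_{s,i}(a) lies in a set of 2^l values. This polynomial in a is nonconstant of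
  degree at most L + 2, so each view, forgery and error pattern leave at most (L + 2) 2^l strings w.
  Summing over the 2^(k + n'/2) views for a fixed i and the error patterns in the ball gives the bound.
*)
theory Submission
  imports Defs "HOL-Computational_Algebra.Polynomial"
begin

unbundle no vec_syntax

subsection \<open>Leftover hashing\<close>

lemma card_carrier_vec_bit: "card (carrier_vec n :: bits set) = 2 ^ n"
proof -
  have "bij_betw list_of_vec (carrier_vec n :: bits set) {xs. set xs \<subseteq> {0, 1} \<and> length xs = n}"
  proof (rule bij_betw_byWitness[where f' = vec_of_list])
    show "vec_of_list ` {xs. set xs \<subseteq> {0, 1} \<and> length xs = n} \<subseteq> (carrier_vec n :: bits set)"
      by (auto intro!: carrier_vecI)
  qed (auto simp: vec_list list_vec)
  then have "card (carrier_vec n :: bits set) = card {xs. set xs \<subseteq> {0, 1 :: bit} \<and> length xs = n}"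
    by (rule bij_betw_same_card)
  also have "\<dots> = 2 ^ n"
    by (subst card_lists_length_eq) (auto simp: numeral_2_eq_2)
  finally show ?thesis .
qed

lemma finite_carrier_vec_bit [simp]: "finite (carrier_vec n :: bits set)"
  by (rule card_ge_0_finite) (simp add: card_carrier_vec_bit)

text \<open>Expanding the square pairs any two points of one fibre, so the second moment of an image
  distribution becomes a collision mass, in which sums over keys can be exchanged.\<close>

lemma sum_power2_fibres:
  fixes p :: "'a \<Rightarrow> real"
  assumes "finite D" "finite Z" "f ` D \<subseteq> Z"
  shows "(\<Sum>z\<in>Z. (\<Sum>w | w \<in> D \<and> f w = z. p w)\<^sup>2) =
         (\<Sum>w\<in>D. \<Sum>w' | w' \<in> D \<and> f w' = f w. p w * p w')"
proof -
  have "(\<Sum>w | w \<in> D \<and> f w = z. p w)\<^sup>2 =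
        (\<Sum>w | w \<in> D \<and> f w = z. \<Sum>w' | w' \<in> D \<and> f w' = f w. p w * p w')" for z
    unfolding power2_eq_square sum_product by (intro sum.cong) auto
  then show ?thesis
    using sum.group[OF assms, of "\<lambda>w. \<Sum>w' | w' \<in> D \<and> f w' = f w. p w * p w'"] by simp
qed

text \<open>Cauchy-Schwarz over keys, syndromes and hash values bounds the L1 deviation by the L2
  deviation, which is the collision mass minus its ideal value; universality controls that mass.
  \<open>X\<close> and \<open>P\<close> are joint with the syndrome rather than conditioned on it,
  so the leakage of the sketch enters as the factor \<open>card T\<close>.\<close>

lemma leftover_hash_sum:
  fixes p :: "'w \<Rightarrow> real" and q :: real and g :: "'i \<Rightarrow> 'w \<Rightarrow> 'y" and s :: "'w \<Rightarrow> 's"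
  assumes fin: "finite D" "finite I" "finite T" "finite Y" and "Y \<noteq> {}"
    and p: "\<And>w. w \<in> D \<Longrightarrow> 0 \<le> p w" "\<And>w. w \<in> D \<Longrightarrow> p w \<le> q" "sum p D = 1"
    and s: "\<And>w. w \<in> D \<Longrightarrow> s w \<in> T"
    and g: "\<And>i w. i \<in> I \<Longrightarrow> w \<in> D \<Longrightarrow> g i w \<in> Y"
    and univ: "\<And>w w'. w \<in> D \<Longrightarrow> w' \<in> D \<Longrightarrow> w \<noteq> w' \<Longrightarrow> s w = s w' \<Longrightarrow>
                 card Y * card {i\<in>I. g i w' = g i w} \<le> card I"
  defines "X \<equiv> \<lambda>i c y. \<Sum>w | w \<in> D \<and> s w = c \<and> g i w = y. p w"
    and "P \<equiv> \<lambda>c. \<Sum>w | w \<in> D \<and> s w = c. p w"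
  shows "(\<Sum>i\<in>I. \<Sum>c\<in>T. \<Sum>y\<in>Y. \<bar>X i c y - P c / card Y\<bar>)
         \<le> card I * sqrt (card T * card Y * q)"
proof -
  have Y: "real (card Y) > 0"
    using fin \<open>Y \<noteq> {}\<close> by (simp add: card_gt_0_iff)
  have marg: "(\<Sum>y\<in>Y. X i c y) = P c" if "i \<in> I" for i c
  proof -
    have "X i c y = sum p {w \<in> {w. w \<in> D \<and> s w = c}. g i w = y}" for y
      unfolding X_def by (intro sum.cong) auto
    then show ?thesis
      unfolding P_def using sum.group[of "{w. w \<in> D \<and> s w = c}" Y "g i" p] fin g that by auto
  qed
  \<comment> \<open>By \<open>marg\<close>, \<open>P c / card Y\<close> is the mean of
    \<open>X i c\<close>, so this is the usual variance formula.\<close>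
  have dev: "(\<Sum>y\<in>Y. (X i c y - P c / card Y)\<^sup>2) = (\<Sum>y\<in>Y. (X i c y)\<^sup>2) - (P c)\<^sup>2 / card Y"
    if "i \<in> I" for i c
  proof -
    have "(\<Sum>y\<in>Y. (X i c y - P c / card Y)\<^sup>2)
        = (\<Sum>y\<in>Y. (X i c y)\<^sup>2 - 2 * P c / card Y * X i c y + (P c)\<^sup>2 / (card Y)\<^sup>2)"
      by (intro sum.cong refl) (simp add: power2_diff power_divide)
    also have "\<dots> = (\<Sum>y\<in>Y. (X i c y)\<^sup>2) - 2 * P c / card Y * P c + card Y * ((P c)\<^sup>2 / (card Y)\<^sup>2)"
      unfolding sum.distrib sum_subtractf sum_distrib_left[symmetric] marg[OF that] by simp
    also have "\<dots> = (\<Sum>y\<in>Y. (X i c y)\<^sup>2) - (P c)\<^sup>2 / card Y"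
      using Y by (simp add: field_simps power2_eq_square)
    finally show ?thesis .
  qed
  define E where "E = (\<lambda>w. {w' \<in> D. s w' = s w})"
  have finE: "finite (E w)" for w
    using fin by (simp add: E_def)
  have coll: "(\<Sum>c\<in>T. \<Sum>y\<in>Y. (X i c y)\<^sup>2) = (\<Sum>w\<in>D. \<Sum>w'\<in>E w. p w * p w' * (if g i w' = g i w then 1 else 0))"
    if "i \<in> I" for i
  proof -
    have "(\<Sum>c\<in>T. \<Sum>y\<in>Y. (X i c y)\<^sup>2) = (\<Sum>z\<in>T \<times> Y. (\<Sum>w | w \<in> D \<and> (s w, g i w) = z. p w)\<^sup>2)"
      by (subst sum.cartesian_product) (auto simp: X_def intro!: sum.cong)
    also have "\<dots> = (\<Sum>w\<in>D. \<Sum>w' | w' \<in> D \<and> (s w', g i w') = (s w, g i w). p w * p w')"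
      using fin s g that by (intro sum_power2_fibres) auto
    also have "\<dots> = (\<Sum>w\<in>D. \<Sum>w'\<in>E w. p w * p w' * (if g i w' = g i w then 1 else 0))"
      unfolding E_def using fin by (intro sum.cong refl sum.mono_neutral_cong_left) auto
    finally show ?thesis .
  qed
  have collP: "(\<Sum>c\<in>T. (P c)\<^sup>2) = (\<Sum>w\<in>D. \<Sum>w'\<in>E w. p w * p w')"
    unfolding P_def E_def using fin s by (intro sum_power2_fibres) auto
  \<comment> \<open>Distinct strings are bounded by \<open>univ\<close>, the diagonal by
    \<open>p w \<le> q\<close>. The diagonal also receives the term with
    \<open>card I / card Y\<close>, as slack, so that the sum over all of \<open>E w\<close>
    reassembles the second moment of \<open>P\<close>.\<close>
  have pair: "p w * p w' * card {i\<in>I. g i w' = g i w}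
      \<le> p w * p w' * card I / card Y + (if w' = w then p w * q * card I else 0)"
    if "w \<in> D" "w' \<in> E w" for w w'
  proof (cases "w' = w")
    case True
    have "p w * p w * card I \<le> p w * q * card I"
      using p that by (intro mult_right_mono mult_left_mono) auto
    moreover have "0 \<le> p w * p w * card I / card Y"
      using p that by simp
    ultimately have "p w * p w * card I \<le> p w * p w * card I / card Y + p w * q * card I"
      by linarith
    then show ?thesis
      unfolding True by simp
  next
    case False
    have "real (card Y * card {i\<in>I. g i w' = g i w}) \<le> card I"
      using univ[of w w'] that False by (intro of_nat_mono) (auto simp: E_def)
    then have "card {i\<in>I. g i w' = g i w} \<le> card I / card Y"
      using Y by (simp add: field_simps)
    then have "p w * p w' * card {i\<in>I. g i w' = g i w} \<le> p w * p w' * (card I / card Y)"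
      using p that by (intro mult_left_mono) (auto simp: E_def)
    then show ?thesis
      using False by simp
  qed
  have "(\<Sum>i\<in>I. \<Sum>c\<in>T. \<Sum>y\<in>Y. (X i c y)\<^sup>2)
      = (\<Sum>i\<in>I. \<Sum>w\<in>D. \<Sum>w'\<in>E w. p w * p w' * (if g i w' = g i w then 1 else 0))"
    by (intro sum.cong refl coll)
  also have "\<dots> = (\<Sum>w\<in>D. \<Sum>w'\<in>E w. \<Sum>i\<in>I. p w * p w' * (if g i w' = g i w then 1 else 0))"
    by (subst sum.swap, intro sum.cong refl, rule sum.swap)
  also have "\<dots> = (\<Sum>w\<in>D. \<Sum>w'\<in>E w. p w * p w' * card {i\<in>I. g i w' = g i w})"
    using fin by (simp add: sum_distrib_left[symmetric] sum.If_cases Int_def)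
  also have "\<dots> \<le> (\<Sum>w\<in>D. \<Sum>w'\<in>E w. p w * p w' * card I / card Y + (if w' = w then p w * q * card I else 0))"
    by (intro sum_mono pair)
  also have "\<dots> = (\<Sum>w\<in>D. (\<Sum>w'\<in>E w. p w * p w') * (card I / card Y) + p w * (q * card I))"
  proof (intro sum.cong refl)
    fix w assume "w \<in> D"
    then have "w \<in> E w" by (simp add: E_def)
    then have "(\<Sum>w'\<in>E w. if w' = w then p w * q * card I else 0) = p w * (q * card I)"
      using finE by simp
    then show "(\<Sum>w'\<in>E w. p w * p w' * card I / card Y + (if w' = w then p w * q * card I else 0))
        = (\<Sum>w'\<in>E w. p w * p w') * (card I / card Y) + p w * (q * card I)"
      by (simp add: sum.distrib sum_distrib_right sum_divide_distrib)
  qed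
  also have "\<dots> = (\<Sum>c\<in>T. (P c)\<^sup>2) * (card I / card Y) + q * card I"
    unfolding collP sum.distrib sum_distrib_right[symmetric] p(3) by simp
  finally have sq: "(\<Sum>i\<in>I. \<Sum>c\<in>T. \<Sum>y\<in>Y. (X i c y)\<^sup>2) \<le> (\<Sum>c\<in>T. (P c)\<^sup>2) * (card I / card Y) + q * card I" .
  have "(\<Sum>i\<in>I. \<Sum>c\<in>T. \<Sum>y\<in>Y. (X i c y - P c / card Y)\<^sup>2)
      = (\<Sum>i\<in>I. \<Sum>c\<in>T. (\<Sum>y\<in>Y. (X i c y)\<^sup>2) - (P c)\<^sup>2 / card Y)"
    by (intro sum.cong refl dev)
  also have "\<dots> = (\<Sum>i\<in>I. \<Sum>c\<in>T. \<Sum>y\<in>Y. (X i c y)\<^sup>2) - (\<Sum>c\<in>T. (P c)\<^sup>2) * (card I / card Y)"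
    by (simp add: sum_subtractf flip: sum_divide_distrib)
  also have "\<dots> \<le> q * card I"
    using sq by simp
  finally have var: "(\<Sum>i\<in>I. \<Sum>c\<in>T. \<Sum>y\<in>Y. (X i c y - P c / card Y)\<^sup>2) \<le> q * card I" .
  have "(\<Sum>i\<in>I. \<Sum>c\<in>T. \<Sum>y\<in>Y. \<bar>X i c y - P c / card Y\<bar>)\<^sup>2
      = (\<Sum>(i, c, y)\<in>I \<times> T \<times> Y. 1 * \<bar>X i c y - P c / card Y\<bar>)\<^sup>2"
    by (simp add: sum.cartesian_product)
  also have "\<dots> \<le> (\<Sum>(i, c, y)\<in>I \<times> T \<times> Y. 1\<^sup>2) * (\<Sum>(i, c, y)\<in>I \<times> T \<times> Y. \<bar>X i c y - P c / card Y\<bar>\<^sup>2)"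
    using Cauchy_Schwarz_ineq_sum[of "\<lambda>_. 1" "\<lambda>(i, c, y). \<bar>X i c y - P c / card Y\<bar>" "I \<times> T \<times> Y"]
    by (simp add: case_prod_unfold)
  also have "\<dots> = card I * card T * card Y * (\<Sum>i\<in>I. \<Sum>c\<in>T. \<Sum>y\<in>Y. (X i c y - P c / card Y)\<^sup>2)"
    by (simp add: sum.cartesian_product case_prod_unfold card_cartesian_product)
  also have "\<dots> \<le> card I * card T * card Y * (q * card I)"
    by (intro mult_left_mono var) auto
  also have "\<dots> = (card I)\<^sup>2 * (card T * card Y * q)"
    by (simp add: power2_eq_square)
  finally have "(\<Sum>i\<in>I. \<Sum>c\<in>T. \<Sum>y\<in>Y. \<bar>X i c y - P c / card Y\<bar>)
      \<le> sqrt ((card I)\<^sup>2 * (card T * card Y * q))"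
    by (rule real_le_rsqrt)
  also have "\<dots> = card I * sqrt (card T * card Y * q)"
    by (simp only: real_sqrt_mult real_sqrt_abs of_nat_power abs_of_nat)
  finally show ?thesis .
qed

text \<open>The mean lies within the average deviation from any constant \<open>K\<close>, so by the
  triangle inequality centring at the mean at most doubles the total deviation.\<close>

lemma sum_abs_diff_mean_le:
  fixes x :: "'a \<Rightarrow> real"
  assumes "finite A"
  shows "(\<Sum>a\<in>A. \<bar>x a - sum x A / card A\<bar>) \<le> 2 * (\<Sum>a\<in>A. \<bar>x a - K\<bar>)"
proof (cases "A = {}")
  case False
  then have A: "real (card A) > 0"
    using assms by (simp add: card_gt_0_iff)
  have "K - sum x A / card A = (\<Sum>a\<in>A. K - x a) / card A"
    using A by (simp add: sum_subtractf field_simps)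
  then have "\<bar>K - sum x A / card A\<bar> \<le> (\<Sum>a\<in>A. \<bar>x a - K\<bar>) / card A"
    using A sum_abs[of "\<lambda>a. K - x a" A] by (simp add: divide_right_mono abs_minus_commute)
  then have "(\<Sum>a\<in>A. \<bar>x a - K\<bar> + \<bar>K - sum x A / card A\<bar>) \<le> 2 * (\<Sum>a\<in>A. \<bar>x a - K\<bar>)"
    using A by (simp add: sum.distrib pos_le_divide_eq mult.commute)
  moreover have "(\<Sum>a\<in>A. \<bar>x a - sum x A / card A\<bar>) \<le> (\<Sum>a\<in>A. \<bar>x a - K\<bar> + \<bar>K - sum x A / card A\<bar>)"
    by (intro sum_mono) linarith
  ultimately show ?thesis
    by linarith
qed simp

section \<open>From counting to statistical distance and forgery probability\<close>

lemma measure_bind_pmf_eq: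
  "measure_pmf.prob (bind_pmf M f) E = measure_pmf.expectation M (\<lambda>x. measure_pmf.prob (f x) E)"
proof -
  have pmf_True: "measure_pmf.prob N E = pmf (map_pmf (\<lambda>x. x \<in> E) N) True" for N
    by (simp add: pmf_map vimage_def)
  show ?thesis
    unfolding pmf_True map_bind_pmf pmf_bind ..
qed

lemma min_entropy_imp_pmf_le:
  assumes "min_entropy W \<ge> m"
  shows "pmf W w \<le> 2 powr (- m)"
proof -
  have bdd: "bdd_above (range (pmf W))"
    by (auto simp: bdd_above_def intro: pmf_le_1)
  \<comment> \<open>The logarithm can be inverted only at a positive supremum, and a point of the
    support witnesses positivity.\<close>
  obtain w0 where "w0 \<in> set_pmf W"
    using set_pmf_not_empty[of W] by blast
  then have "0 < pmf W w0"
    by (simp add: pmf_positive)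
  also have "\<dots> \<le> (SUP w. pmf W w)"
    using bdd by (intro cSUP_upper) auto
  finally have "(SUP w. pmf W w) \<le> 2 powr (- m)"
    using assms unfolding min_entropy_def by (subst (asm) le_minus_iff) (simp add: log_le_iff)
  moreover have "pmf W w \<le> (SUP w. pmf W w)"
    using bdd by (intro cSUP_upper) auto
  ultimately show ?thesis
    by linarith
qed

text \<open>The strings \<open>r i w\<close> and \<open>u i w\<close> together form the hash of \<open>w\<close> under the key \<open>i\<close>,
  of which only \<open>u i w\<close> is published.\<close>

lemma stat_dist_extractor_le:
  fixes W :: "'w pmf" and q :: real and r :: "'i \<Rightarrow> 'w \<Rightarrow> 'a" and u :: "'i \<Rightarrow> 'w \<Rightarrow> 'b" and s :: "'w \<Rightarrow> 's"
  assumes fin: "finite D" "finite I" "finite T" "finite A" "finite V" and I: "I \<noteq> {}"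
    and W: "set_pmf W \<subseteq> D" and q: "\<And>w. pmf W w \<le> q"
    and s: "\<And>w. w \<in> D \<Longrightarrow> s w \<in> T"
    and r: "\<And>i w. i \<in> I \<Longrightarrow> w \<in> D \<Longrightarrow> r i w \<in> A"
    and u: "\<And>i w. i \<in> I \<Longrightarrow> w \<in> D \<Longrightarrow> u i w \<in> V"
    and univ: "\<And>w w'. w \<in> D \<Longrightarrow> w' \<in> D \<Longrightarrow> w \<noteq> w' \<Longrightarrow> s w = s w' \<Longrightarrow>
                 card A * card V * card {i\<in>I. r i w' = r i w \<and> u i w' = u i w} \<le> card I"
    and Gen: "\<And>w. w \<in> D \<Longrightarrow> Gen w = map_pmf (\<lambda>i. (r i w, (s w, i, u i w))) (pmf_of_set I)"
  shows "stat_dist (bind_pmf W Gen) (pair_pmf (pmf_of_set A) (map_pmf snd (bind_pmf W Gen)))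
         \<le> sqrt (card T * (card A * card V) * q)"
proof -
  obtain w0 i0 where "w0 \<in> D" "i0 \<in> I"
    using W I set_pmf_not_empty[of W] by blast
  then have ne: "A \<noteq> {}" "V \<noteq> {}"
    using r u by auto
  have cI: "real (card I) > 0" and cA: "real (card A) > 0"
    using fin I ne by (auto simp: card_gt_0_iff)
  define J where "J = bind_pmf W Gen"
  define X where "X = (\<lambda>i c y. \<Sum>w | w \<in> D \<and> s w = c \<and> (r i w, u i w) = y. pmf W w)"
  define P where "P = (\<lambda>c. \<Sum>w | w \<in> D \<and> s w = c. pmf W w)"
  have supp: "set_pmf J \<subseteq> A \<times> T \<times> I \<times> V"
    using W s r u fin I by (auto simp: J_def Gen subset_iff)
  have J: "pmf J (\<rho>, c, i, \<nu>) = X i c (\<rho>, \<nu>) / card I" if "i \<in> I" for \<rho> c i \<nu>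
  proof -
    have Gen_pmf: "pmf (Gen w) (\<rho>, c, i, \<nu>) = (if s w = c \<and> (r i w, u i w) = (\<rho>, \<nu>) then 1 / card I else 0)"
      if "w \<in> D" for w
    proof -
      have "pmf (Gen w) (\<rho>, c, i, \<nu>)
          = measure_pmf.prob (pmf_of_set I) {j. (r j w, s w, j, u j w) = (\<rho>, c, i, \<nu>)}"
        by (simp add: Gen[OF that] pmf_map vimage_def)
      also have "\<dots> = card (I \<inter> {j. (r j w, s w, j, u j w) = (\<rho>, c, i, \<nu>)}) / card I"
        by (rule measure_pmf_of_set[OF I fin(2)])
      \<comment> \<open>The helper string contains the key, so no key other than \<open>i\<close>
        can produce this output.\<close>
      also have "I \<inter> {j. (r j w, s w, j, u j w) = (\<rho>, c, i, \<nu>)}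
          = (if s w = c \<and> (r i w, u i w) = (\<rho>, \<nu>) then {i} else {})"
        using \<open>i \<in> I\<close> by auto
      finally show ?thesis
        by simp
    qed
    have "pmf J (\<rho>, c, i, \<nu>) = (\<Sum>w\<in>D. pmf (Gen w) (\<rho>, c, i, \<nu>) * pmf W w)"
      unfolding J_def pmf_bind using W fin by (intro integral_measure_pmf_real) auto
    also have "\<dots> = (\<Sum>w\<in>D. if s w = c \<and> (r i w, u i w) = (\<rho>, \<nu>) then pmf W w / card I else 0)"
      by (intro sum.cong refl) (simp add: Gen_pmf)
    also have "\<dots> = (\<Sum>w | w \<in> D \<and> s w = c \<and> (r i w, u i w) = (\<rho>, \<nu>). pmf W w / card I)"
      using fin by (intro sum.mono_neutral_cong_right) auto
    finally show ?thesis
      by (simp add: X_def sum_divide_distrib)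
  qed
  have snd_J: "pmf (map_pmf snd J) z = (\<Sum>\<rho>\<in>A. pmf J (\<rho>, z))" for z
  proof -
    have "pmf (map_pmf snd J) z = measure_pmf.prob J {x. snd x = z}"
      by (simp add: pmf_map vimage_def)
    also have "\<dots> = measure_pmf.prob J ({x. snd x = z} \<inter> set_pmf J)"
      by (simp add: measure_Int_set_pmf)
    also have "\<dots> = measure_pmf.prob J ((A \<times> {z}) \<inter> set_pmf J)"
      using supp by (intro arg_cong2[where f = measure] refl) auto
    also have "\<dots> = (\<Sum>x\<in>A \<times> {z}. pmf J x)"
      using fin by (simp add: measure_Int_set_pmf measure_measure_pmf_finite)
    also have "\<dots> = (\<Sum>\<rho>\<in>A. pmf J (\<rho>, z))"
      by (simp add: sum.cartesian_product')
    finally show ?thesis .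
  qed
  define U where "U = pair_pmf (pmf_of_set A) (map_pmf snd J)"
  have U: "pmf U (\<rho>, z) = (\<Sum>\<rho>\<in>A. pmf J (\<rho>, z)) / card A" if "\<rho> \<in> A" for \<rho> z
    using that fin ne by (simp add: U_def pmf_pair snd_J)
  have suppU: "set_pmf U \<subseteq> A \<times> T \<times> I \<times> V"
    using supp fin ne by (force simp: U_def)
  have scale: "\<bar>a / card I - b / card I\<bar> = \<bar>a - b\<bar> / card I" for a b :: real
    by (simp flip: diff_divide_distrib)
  have "(\<Sum>\<^sub>\<infinity>x. \<bar>pmf J x - pmf U x\<bar>) = (\<Sum>\<^sub>\<infinity>x\<in>A \<times> T \<times> I \<times> V. \<bar>pmf J x - pmf U x\<bar>)"
  proof (rule infsum_cong_neutral)
    fix x assume "x \<in> UNIV - A \<times> T \<times> I \<times> V"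
    then have "pmf J x = 0" "pmf U x = 0"
      using supp suppU by (auto simp: pmf_eq_0_set_pmf)
    then show "\<bar>pmf J x - pmf U x\<bar> = 0"
      by simp
  qed auto
  also have "\<dots> = (\<Sum>x\<in>A \<times> T \<times> I \<times> V. \<bar>pmf J x - pmf U x\<bar>)"
    using fin by (intro infsum_finite) auto
  also have "\<dots> = (\<Sum>\<rho>\<in>A. \<Sum>z\<in>T \<times> I \<times> V. \<bar>pmf J (\<rho>, z) - pmf U (\<rho>, z)\<bar>)"
    by (rule sum.cartesian_product')
  also have "\<dots> = (\<Sum>z\<in>T \<times> I \<times> V. \<Sum>\<rho>\<in>A. \<bar>pmf J (\<rho>, z) - pmf U (\<rho>, z)\<bar>)"
    by (rule sum.swap)
  also have "\<dots> = (\<Sum>z\<in>T \<times> I \<times> V. \<Sum>\<rho>\<in>A. \<bar>pmf J (\<rho>, z) - (\<Sum>\<rho>\<in>A. pmf J (\<rho>, z)) / card A\<bar>)"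
    by (intro sum.cong refl) (simp add: U)
  \<comment> \<open>Replacing \<open>R\<close> by a uniform string averages the mass over all
    extracted strings while the helper string \<open>z\<close> stays fixed. Comparing instead with
    the constant mass of a fully uniform hash costs a factor two, which the \<open>1/2\<close> in
    \<open>stat_dist\<close> absorbs.\<close>
  also have "\<dots> \<le> (\<Sum>z\<in>T \<times> I \<times> V. 2 * (\<Sum>\<rho>\<in>A. \<bar>pmf J (\<rho>, z) - P (fst z) / card (A \<times> V) / card I\<bar>))"
    using fin by (intro sum_mono sum_abs_diff_mean_le)
  also have "\<dots> = 2 / card I * (\<Sum>z\<in>T \<times> I \<times> V. \<Sum>\<rho>\<in>A.
      \<bar>X (fst (snd z)) (fst z) (\<rho>, snd (snd z)) - P (fst z) / card (A \<times> V)\<bar>)"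
    unfolding sum_distrib_left
    by (intro sum.cong refl) (auto simp: J scale simp del: divide_divide_eq_left)
  also have "(\<Sum>z\<in>T \<times> I \<times> V. \<Sum>\<rho>\<in>A.
      \<bar>X (fst (snd z)) (fst z) (\<rho>, snd (snd z)) - P (fst z) / card (A \<times> V)\<bar>)
      = (\<Sum>c\<in>T. \<Sum>i\<in>I. \<Sum>\<nu>\<in>V. \<Sum>\<rho>\<in>A. \<bar>X i c (\<rho>, \<nu>) - P c / card (A \<times> V)\<bar>)"
    by (simp add: sum.cartesian_product')
  also have "\<dots> = (\<Sum>i\<in>I. \<Sum>c\<in>T. \<Sum>\<rho>\<in>A. \<Sum>\<nu>\<in>V. \<bar>X i c (\<rho>, \<nu>) - P c / card (A \<times> V)\<bar>)"
    by (subst sum.swap, intro sum.cong refl, rule sum.swap)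
  also have "\<dots> = (\<Sum>i\<in>I. \<Sum>c\<in>T. \<Sum>y\<in>A \<times> V. \<bar>X i c y - P c / card (A \<times> V)\<bar>)"
    by (simp add: sum.cartesian_product')
  also have "2 / card I * \<dots> \<le> 2 / card I * (card I * sqrt (card T * card (A \<times> V) * q))"
  proof (intro mult_left_mono)
    have "sum (pmf W) D = 1"
      by (rule sum_pmf_eq_1[OF fin(1) W])
    then show "(\<Sum>i\<in>I. \<Sum>c\<in>T. \<Sum>y\<in>A \<times> V. \<bar>X i c y - P c / card (A \<times> V)\<bar>)
        \<le> card I * sqrt (card T * card (A \<times> V) * q)"
      unfolding X_def P_def using fin ne q s r u univ
      by (intro leftover_hash_sum) (auto simp: card_cartesian_product)
  qed simp
  also have "\<dots> = 2 * sqrt (card T * (card A * card V) * q)"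
    using cI by (simp add: card_cartesian_product)
  finally show ?thesis
    unfolding stat_dist_def J_def U_def by simp
qed

text \<open>Conditioned on the adversary's view \<open>(\<rho>, c, i, \<nu>)\<close>, every forgery it may choose succeeds
  for at most \<open>N\<close> pairs, each of probability at most \<open>q\<close>; a randomized choice only averages.\<close>

lemma prob_forgery_le:
  fixes WW :: "('w \<times> 'x) pmf" and q :: real and r :: "'i \<Rightarrow> 'w \<Rightarrow> 'a" and u :: "'i \<Rightarrow> 'w \<Rightarrow> 'b" and s :: "'w \<Rightarrow> 's"
    and A :: "'a \<Rightarrow> ('s \<times> 'i \<times> 'b) \<Rightarrow> ('s \<times> 'i \<times> 'b) pmf"
  assumes fin: "finite (set_pmf WW)" "finite I" "finite T" "finite R" "finite V" and I: "I \<noteq> {}"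
    and q: "\<And>z. pmf WW z \<le> q"
    and s: "\<And>w w'. (w, w') \<in> set_pmf WW \<Longrightarrow> s w \<in> T"
    and r: "\<And>i w w'. i \<in> I \<Longrightarrow> (w, w') \<in> set_pmf WW \<Longrightarrow> r i w \<in> R"
    and u: "\<And>i w w'. i \<in> I \<Longrightarrow> (w, w') \<in> set_pmf WW \<Longrightarrow> u i w \<in> V"
    and Gen: "\<And>w w'. (w, w') \<in> set_pmf WW \<Longrightarrow> Gen w = map_pmf (\<lambda>i. (r i w, (s w, i, u i w))) (pmf_of_set I)"
    and count: "\<And>i c \<rho> \<nu> P'. i \<in> I \<Longrightarrow> c \<in> T \<Longrightarrow> P' \<noteq> (c, i, \<nu>) \<Longrightarrow>
        card {z \<in> set_pmf WW. s (fst z) = c \<and> r i (fst z) = \<rho> \<and> u i (fst z) = \<nu> \<and> acc (snd z) P'} \<le> N"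
  shows "measure_pmf.prob
          (bind_pmf WW (\<lambda>(w, w'). bind_pmf (Gen w) (\<lambda>(\<rho>, P).
             bind_pmf (A \<rho> P) (\<lambda>P'. return_pmf (P, P', w')))))
          {(P, P', w'). P' \<noteq> P \<and> acc w' P'} \<le> card T * (card R * card V) * (real N * q)"
proof -
  define E where "E = {(P, P', w'). P' \<noteq> P \<and> acc w' P'}"
  define F where "F = (\<lambda>i c \<rho> \<nu>. {z \<in> set_pmf WW. s (fst z) = c \<and> r i (fst z) = \<rho> \<and> u i (fst z) = \<nu>})"
  define win where "win = (\<lambda>(z :: 'w \<times> 'x) P. {P'. P' \<noteq> P \<and> acc (snd z) P'})"
  define G where "G = (\<lambda>z i. measure_pmf.prob (A (r i (fst z)) (s (fst z), i, u i (fst z))) (win z (s (fst z), i, u i (fst z))))"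
  have cI: "real (card I) > 0"
    using fin I by (auto simp: card_gt_0_iff)
  have q0: "0 \<le> q"
    by (rule order_trans[OF pmf_nonneg q])
  have step: "measure_pmf.prob (bind_pmf (Gen (fst z)) (\<lambda>(\<rho>, P). bind_pmf (A \<rho> P) (\<lambda>P'. return_pmf (P, P', snd z)))) E
      = (\<Sum>i\<in>I. G z i) / card I" if "z \<in> set_pmf WW" for z
  proof -
    have "measure_pmf.prob (bind_pmf (Gen (fst z)) (\<lambda>(\<rho>, P). bind_pmf (A \<rho> P) (\<lambda>P'. return_pmf (P, P', snd z)))) E
       = measure_pmf.expectation (pmf_of_set I) (\<lambda>i. G z i)"
      using that
      by (simp add: Gen[of "fst z" "snd z"] bind_map_pmf measure_bind_pmf_eq[of "pmf_of_set I"]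
          map_pmf_def[symmetric] vimage_def E_def G_def win_def)
    also have "\<dots> = (\<Sum>i\<in>I. G z i) / card I"
      using fin I by (simp add: integral_pmf_of_set)
    finally show ?thesis .
  qed
  \<comment> \<open>On one fibre the view is constant, so the adversary answers with the same
    distribution for every \<open>z\<close>. The sum moves inside a single expectation and can be
    bounded for each fixed answer.\<close>
  have fibre: "(\<Sum>z\<in>F i c \<rho> \<nu>. pmf WW z * G z i) \<le> real N * q" if i: "i \<in> I" and c: "c \<in> T" for i c \<rho> \<nu>
  proof -
    have finF: "finite (F i c \<rho> \<nu>)"
      using fin by (simp add: F_def)
    have G: "G z i = measure_pmf.expectation (A \<rho> (c, i, \<nu>)) (indicator (win z (c, i, \<nu>)))"
      if "z \<in> F i c \<rho> \<nu>" for z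
      using that by (auto simp: F_def G_def)
    have "(\<Sum>z\<in>F i c \<rho> \<nu>. pmf WW z * G z i)
        = (\<Sum>z\<in>F i c \<rho> \<nu>. measure_pmf.expectation (A \<rho> (c, i, \<nu>)) (\<lambda>P'. pmf WW z * indicator (win z (c, i, \<nu>)) P'))"
      by (intro sum.cong refl) (simp add: G)
    also have "\<dots> = measure_pmf.expectation (A \<rho> (c, i, \<nu>))
        (\<lambda>P'. \<Sum>z\<in>F i c \<rho> \<nu>. pmf WW z * indicator (win z (c, i, \<nu>)) P')"
      by (intro Bochner_Integration.integral_sum[symmetric] integrable_mult_right)
         (simp add: measure_pmf.integrable_const_bound[where B = 1])
    also have "\<dots> \<le> real N * q"
    proof (rule measure_pmf.integral_le_const)
      show "integrable (measure_pmf (A \<rho> (c, i, \<nu>))) (\<lambda>P'. \<Sum>z\<in>F i c \<rho> \<nu>. pmf WW z * indicator (win z (c, i, \<nu>)) P')"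
        by (intro Bochner_Integration.integrable_sum integrable_mult_right)
           (simp add: measure_pmf.integrable_const_bound[where B = 1])
      show "AE P' in measure_pmf (A \<rho> (c, i, \<nu>)). (\<Sum>z\<in>F i c \<rho> \<nu>. pmf WW z * indicator (win z (c, i, \<nu>)) P') \<le> real N * q"
      proof (intro AE_I2)
        fix P'
        let ?Z = "{z \<in> F i c \<rho> \<nu>. P' \<in> win z (c, i, \<nu>)}"
        have "(\<Sum>z\<in>F i c \<rho> \<nu>. pmf WW z * indicator (win z (c, i, \<nu>)) P') = (\<Sum>z\<in>?Z. pmf WW z)"
          using finF by (intro sum.mono_neutral_cong_right) (auto simp: indicator_def)
        also have "\<dots> \<le> card ?Z * q"
          by (rule sum_bounded_above) (rule q)
        also have "\<dots> \<le> real N * q"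
        proof (intro mult_right_mono q0, rule of_nat_mono)
          show "card ?Z \<le> N"
          \<comment> \<open>Repeating the original helper string is never a win and leaves an empty
            set; \<open>count\<close> covers every other answer.\<close>
          proof (cases "P' = (c, i, \<nu>)")
            case False
            then have "?Z = {z \<in> set_pmf WW. s (fst z) = c \<and> r i (fst z) = \<rho> \<and> u i (fst z) = \<nu> \<and> acc (snd z) P'}"
              by (auto simp: F_def win_def)
            then show ?thesis
              using count[OF i c False] by simp
          qed (simp add: win_def)
        qed
        finally show "(\<Sum>z\<in>F i c \<rho> \<nu>. pmf WW z * indicator (win z (c, i, \<nu>)) P') \<le> real N * q" .
      qed
    qed
    finally show ?thesis .
  qed
  \<comment> \<open>The views for one key are partitioned by syndrome and hash value. Keys are
    averaged at the end, so their number does not enter the bound.\<close>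
  have per_key: "(\<Sum>z\<in>set_pmf WW. pmf WW z * G z i) \<le> card T * (card R * card V) * (real N * q)" if i: "i \<in> I" for i
  proof -
    have "(\<Sum>z\<in>set_pmf WW. pmf WW z * G z i)
        = (\<Sum>y\<in>T \<times> R \<times> V. \<Sum>z | z \<in> set_pmf WW \<and> (s (fst z), r i (fst z), u i (fst z)) = y. pmf WW z * G z i)"
      using fin s r u i by (intro sum.group[symmetric]) auto
    also have "\<dots> \<le> (\<Sum>y\<in>T \<times> R \<times> V. real N * q)"
    proof (intro sum_mono)
      fix y assume y: "y \<in> T \<times> R \<times> V"
      obtain c \<rho> \<nu> where [simp]: "y = (c, \<rho>, \<nu>)"
        by (cases y)
      show "(\<Sum>z | z \<in> set_pmf WW \<and> (s (fst z), r i (fst z), u i (fst z)) = y. pmf WW z * G z i) \<le> real N * q"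
        using fibre[OF i, of c \<rho> \<nu>] y by (simp add: F_def)
    qed
    also have "\<dots> = card T * (card R * card V) * (real N * q)"
      by (simp add: card_cartesian_product)
    finally show ?thesis .
  qed
  have "measure_pmf.prob (bind_pmf WW (\<lambda>(w, w'). bind_pmf (Gen w) (\<lambda>(\<rho>, P).
             bind_pmf (A \<rho> P) (\<lambda>P'. return_pmf (P, P', w'))))) E
      = measure_pmf.expectation WW (\<lambda>z. measure_pmf.prob (bind_pmf (Gen (fst z)) (\<lambda>(\<rho>, P).
             bind_pmf (A \<rho> P) (\<lambda>P'. return_pmf (P, P', snd z)))) E)"
    by (simp add: measure_bind_pmf_eq[of WW] case_prod_unfold)
  also have "\<dots> = (\<Sum>z\<in>set_pmf WW. measure_pmf.prob (bind_pmf (Gen (fst z)) (\<lambda>(\<rho>, P).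
             bind_pmf (A \<rho> P) (\<lambda>P'. return_pmf (P, P', snd z)))) E * pmf WW z)"
    using fin by (intro integral_measure_pmf_real) auto
  also have "\<dots> = (\<Sum>z\<in>set_pmf WW. \<Sum>i\<in>I. pmf WW z * G z i) / card I"
    unfolding sum_divide_distrib
    by (intro sum.cong refl) (simp add: step sum_divide_distrib sum_distrib_left sum_distrib_right mult.commute)
  also have "\<dots> = (\<Sum>i\<in>I. \<Sum>z\<in>set_pmf WW. pmf WW z * G z i) / card I"
    by (subst sum.swap) simp
  also have "\<dots> \<le> (\<Sum>i\<in>I. card T * (card R * card V) * (real N * q)) / card I"
    by (intro divide_right_mono sum_mono per_key) auto
  also have "\<dots> = card T * (card R * card V) * (real N * q)"
    using cI by simp
  finally show ?thesis
    unfolding E_def .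
qed

subsection \<open>Shifted polynomials and bit strings\<close>

text \<open>The factor \<open>Suc N\<close> is where parity enters: for nonzero
  \<open>\<alpha>\<close> in characteristic 2, the second highest coefficient survives exactly when
  the exponent is odd.\<close>

lemma coeff_linear_power_Suc:
  "coeff ([:\<alpha>, 1:] ^ Suc N) N = of_nat (Suc N) * (\<alpha> :: 'a::comm_semiring_1)"
  by (subst coeff_linear_poly_power) auto

lemma coeff_linear_power_eq_0: "N < M \<Longrightarrow> coeff ([:\<alpha> :: 'a::idom, 1:] ^ N) M = 0"
  by (rule coeff_eq_0) (simp add: degree_linear_power)

text \<open>Since \<open>L + 3\<close> is odd, a shift by \<open>\<alpha> \<noteq> 0\<close> leaves the term \<open>\<alpha> x ^ (L + 2)\<close> in
  characteristic 2, whereas for \<open>\<alpha> = 0\<close> the difference of the lower coefficients survives.\<close>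

lemma card_shifted_difference_roots:
  fixes c d :: "nat \<Rightarrow> 'f::field"
  assumes char2: "(1 :: 'f) + 1 = 0" and L: "even L"
    and ne: "\<alpha> \<noteq> 0 \<or> (\<exists>j<L. c j \<noteq> d j) \<or> i \<noteq> i'"
  defines "F \<equiv> \<lambda>c i x. x ^ (L + 3) + x ^ 2 * (\<Sum>j<L. c j * x ^ j) + i * x"
  shows "finite {x. F d i' (x + \<alpha>) - F c i x = z}"
    and "card {x. F d i' (x + \<alpha>) - F c i x = z} \<le> L + 2"
proof -
  \<comment> \<open>The shifted terms stay powers of \<open>[:\<alpha>, 1:]\<close>, so that their
    top coefficients can be read off without a full expansion.\<close>
  define Q where "Q = [:\<alpha>, 1:] ^ (L + 3) + (\<Sum>j<L. Polynomial.smult (d j) ([:\<alpha>, 1:] ^ (j + 2))) + Polynomial.smult i' [:\<alpha>, 1:]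
    - (monom 1 (L + 3) + (\<Sum>j<L. monom (c j) (j + 2)) + monom i 1) - [:z:]"
  have poly_Q: "poly Q x = F d i' (x + \<alpha>) - F c i x - z" for x
  proof -
    have lin: "poly ([:\<alpha>, 1:] ^ N) x = (x + \<alpha>) ^ N" for N
      by (simp add: add.commute)
    have "poly (\<Sum>j<L. Polynomial.smult (d j) ([:\<alpha>, 1:] ^ (j + 2))) x = (x + \<alpha>)\<^sup>2 * (\<Sum>j<L. d j * (x + \<alpha>) ^ j)"
      "poly (\<Sum>j<L. monom (c j) (j + 2)) x = x\<^sup>2 * (\<Sum>j<L. c j * x ^ j)"
      unfolding poly_sum sum_distrib_left
      by (simp_all only: poly_smult poly_mult lin poly_monom power_add mult.left_commute mult.commute)
    then show ?thesis
      by (simp add: Q_def F_def poly_monom add.commute[of \<alpha>] distrib_left add.commute[of "i' * \<alpha>"])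
  qed
  \<comment> \<open>The exponents \<open>j + 2\<close> with \<open>j < L\<close> reach at most
    \<open>L + 1\<close>, so the middle sums cannot disturb the top coefficients examined
    below.\<close>
  have coeff_high: "coeff (\<Sum>j<L. Polynomial.smult (d j) ([:\<alpha>, 1:] ^ (j + 2))) N = 0"
    "coeff (\<Sum>j<L. monom (c j) (j + 2)) N = 0" if "N \<ge> L + 2" for N
  proof -
    have "coeff ([:\<alpha>, 1:] ^ (j + 2)) N = 0" "coeff (monom (c j) (j + 2)) N = 0" if "j < L" for j
      using that \<open>N \<ge> L + 2\<close> by (intro coeff_linear_power_eq_0, simp_all)
    then show "coeff (\<Sum>j<L. Polynomial.smult (d j) ([:\<alpha>, 1:] ^ (j + 2))) N = 0"
      "coeff (\<Sum>j<L. monom (c j) (j + 2)) N = 0"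
      unfolding coeff_sum coeff_smult by (intro sum.neutral ballI; simp only: lessThan_iff mult_zero_right)+
  qed
  have coeff_lin: "coeff (Polynomial.smult i' [:\<alpha>, 1:]) N = 0" "coeff (monom i 1) N = 0" "coeff [:z:] N = 0" if "N \<ge> L + 2" for N
    using that by (auto simp: coeff_pCons split: nat.splits)
  \<comment> \<open>Both leading terms are \<open>x ^ (L + 3)\<close>, so they cancel and the degree
    drops by one.\<close>
  have deg: "degree Q \<le> L + 2"
  proof (rule degree_le, intro allI impI)
    fix N assume N: "N > L + 2"
    have "coeff ([:\<alpha>, 1:] ^ (L + 3)) N = coeff (monom 1 (L + 3)) N"
      using N by (cases "N = L + 3") (auto simp: coeff_linear_power coeff_linear_power_eq_0 simp del: power_Suc)
    then show "coeff Q N = 0"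
      using N coeff_high[of N] coeff_lin[of N] by (simp add: Q_def del: power_Suc)
  qed
  have "Q \<noteq> 0"
  proof (cases "\<alpha> = 0")
    case False
    obtain M where M: "L = 2 * M"
      using L by (elim evenE)
    have "(of_nat (Suc (L + 2)) :: 'f) = of_nat (M + 1) * (1 + 1) + 1"
      by (simp add: M algebra_simps)
    then have "(of_nat (Suc (L + 2)) :: 'f) = 1"
      by (simp only: char2 mult_zero_right add_0_left)
    moreover have "L + 3 = Suc (L + 2)"
      by simp
    ultimately have "coeff ([:\<alpha>, 1:] ^ (L + 3)) (L + 2) = \<alpha>"
      by (simp only: coeff_linear_power_Suc mult_1_left)
    then have "coeff Q (L + 2) = \<alpha>"
      using coeff_high[of "L + 2"] coeff_lin[of "L + 2"] by (simp add: Q_def del: power_Suc)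
    then show ?thesis
      using False by auto
  next
    case True
    have x_power: "[:0, 1:] ^ N = (monom 1 N :: 'f poly)" for N
      by (simp add: monom_altdef)
    \<comment> \<open>Without a shift the parameters occupy separate degrees: the factor
      \<open>x ^ 2\<close> moves the coefficient differences to degrees \<open>j + 2\<close>, which
      leaves degree 1 to the keys and degree 0 to \<open>z\<close>, so none can cancel
      another.\<close>
    have Q: "Q = (\<Sum>j<L. monom (d j - c j) (j + 2)) + monom (i' - i) 1 - [:z:]"
      unfolding Q_def True x_power
      by (simp add: x_power[of 1, simplified] smult_monom sum_subtractf flip: diff_monom)
    have "coeff Q 1 = i' - i"
      by (simp add: Q coeff_sum)
    moreover have "coeff Q (j + 2) = d j - c j" if "j < L" for j
      using that by (simp add: Q coeff_sum)
    ultimately show ?thesis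
      using ne True by (metis coeff_0 right_minus_eq)
  qed
  moreover have "{x. F d i' (x + \<alpha>) - F c i x = z} = {x. poly Q x = 0}"
    by (simp add: poly_Q)
  ultimately show "finite {x. F d i' (x + \<alpha>) - F c i x = z}"
    and "card {x. F d i' (x + \<alpha>) - F c i x = z} \<le> L + 2"
    using poly_roots_finite[of Q] card_poly_roots_bound[of Q] deg by auto
qed

section \<open>Vectors over GF(2), Hamming distance and substrings\<close>

lemma add_self_bit_vec: "(x :: bits) \<in> carrier_vec n \<Longrightarrow> x + x = 0\<^sub>v n"
  by (intro eq_vecI) auto

lemma add_cancel_bit_vec:
  "(x :: bits) \<in> carrier_vec n \<Longrightarrow> y \<in> carrier_vec n \<Longrightarrow> x + (x + y) = y"
  by (simp add: assoc_add_vec[symmetric] add_self_bit_vec)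

lemma add_eq_zero_bit_vec:
  assumes "(x :: bits) \<in> carrier_vec n" "y \<in> carrier_vec n" "x + y = 0\<^sub>v n"
  shows "x = y"
  using add_cancel_bit_vec[OF assms(1,2)] assms by simp

text \<open>A sum over GF(2) is nonzero exactly where its summands disagree, so errors can be
  treated as vectors in a ball around zero.\<close>

lemma dis_zero_add:
  assumes "x \<in> carrier_vec n" "y \<in> carrier_vec n"
  shows "dis (0\<^sub>v n) (x + y) = dis x y"
proof -
  have "{j. j < n \<and> 0\<^sub>v n $ j \<noteq> (x + y) $ j} = {j. j < n \<and> x $ j \<noteq> y $ j}"
  proof (intro Collect_cong conj_cong refl)
    fix j assume "j < n"
    then show "(0\<^sub>v n $ j \<noteq> (x + y) $ j) = (x $ j \<noteq> y $ j)"
      using assms by (cases "x $ j"; cases "y $ j") auto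
  qed
  then show ?thesis
    using assms by (simp add: dis_def)
qed

lemma dis_commute: "x \<in> carrier_vec n \<Longrightarrow> y \<in> carrier_vec n \<Longrightarrow> dis x y = dis y x"
  by (auto simp: dis_def intro!: arg_cong[where f = card])

lemma substr_carrier [simp]: "substr x i j \<in> carrier_vec (Suc j - i)"
  by (simp add: substr_def)

lemma substr_add:
  assumes "x \<in> carrier_vec N" "y \<in> carrier_vec N" "1 \<le> i" "j \<le> N"
  shows "substr (x + y) i j = substr x i j + substr y i j"
  using assms by (intro eq_vecI) (auto simp: substr_def)

lemma eq_if_substr_eq:
  assumes "x \<in> carrier_vec N" "y \<in> carrier_vec N" "v \<le> N"
    and "substr x 1 v = substr y 1 v" "substr x (v + 1) N = substr y (v + 1) N"
  shows "x = y"
proof (rule eq_vecI)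
  fix j assume "j < dim_vec y"
  then have j: "j < N"
    using assms by simp
  show "x $ j = y $ j"
  proof (cases "j < v")
    case True
    then show ?thesis
      using arg_cong[OF assms(4), of "\<lambda>z. z $ j"] by (simp add: substr_def)
  next
    case False
    then have "v + (j - v) = j"
      by simp
    then show ?thesis
      using j False arg_cong[OF assms(5), of "\<lambda>z. z $ (j - v)"] by (simp add: substr_def)
  qed
qed (use assms in simp)

subsection \<open>The construction\<close>

text \<open>\<open>SRec_correct\<close> speaks only about sketches of nearby strings.
  \<open>SRec_carrier\<close> also covers forged sketches, so that linear algebra applies to
  whatever \<open>Rep\<close> recovers.\<close>

locale sketch_extractor =
  fixes n k t l :: nat and S Sp :: "bit mat" and SRec :: "bits \<Rightarrow> bits \<Rightarrow> bits"
    and rep :: "'f::field \<Rightarrow> bits"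
  assumes S_dim: "S \<in> carrier_mat k n"
    and Sp_dim: "Sp \<in> carrier_mat (n - k) n"
    and stack_rank: "vec_space.rank n (S @\<^sub>r Sp) = n"
    and SRec_carrier: "\<And>w' s. w' \<in> carrier_vec n \<Longrightarrow> s \<in> carrier_vec k \<Longrightarrow> SRec w' s \<in> carrier_vec n"
    and SRec_correct: "\<And>w w'. w \<in> carrier_vec n \<Longrightarrow> w' \<in> carrier_vec n \<Longrightarrow> dis w w' \<le> t \<Longrightarrow>
          SRec w' (S *\<^sub>v w) = w"
    and n'_even: "even (n - k)"
    and rep_bij: "bij_betw rep UNIV (carrier_vec ((n - k) div 2))"
    and rep_add: "rep (x + y) = rep x + rep y"
    and v_nonneg: "l \<le> (n - k) div 2"
begin

section \<open>The hash and its encoding by field elements\<close>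

definition h where "h = (n - k) div 2"
definition v where "v = h - l"
definition L where "L = Lpar n k"

definition half_a where "half_a w = fromrep rep (substr (Sp *\<^sub>v w) 1 h)"
definition half_b where "half_b w = fromrep rep (substr (Sp *\<^sub>v w) (h + 1) (n - k))"

definition hash where
  "hash i w = rep (fpoly rep h L (S *\<^sub>v w) i (half_a w) + half_b w)"

lemma Gen_eq: "Gen_c n k S Sp rep l w =
    map_pmf (\<lambda>i. (substr (hash i w) (v + 1) h, (S *\<^sub>v w, i, substr (hash i w) 1 v))) (pmf_of_set UNIV)"
  by (simp add: Gen_c_def Let_def hash_def half_a_def half_b_def h_def v_def L_def)

lemma rep_carrier [simp]: "rep x \<in> carrier_vec h"
  using rep_bij by (auto simp: bij_betw_def h_def)

lemma rep_eq_iff [simp]: "rep x = rep y \<longleftrightarrow> x = y"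
  using rep_bij by (auto simp: bij_betw_def inj_on_def)

lemma fromrep_rep [simp]: "fromrep rep (rep x) = x"
  unfolding fromrep_def by (intro inv_into_f_f) (auto simp: inj_on_def)

lemma rep_fromrep: "x \<in> carrier_vec h \<Longrightarrow> rep (fromrep rep x) = x"
  using rep_bij unfolding fromrep_def h_def by (intro bij_betw_inv_into_right)

lemma fromrep_add:
  assumes "x \<in> carrier_vec h" "y \<in> carrier_vec h"
  shows "fromrep rep (x + y) = fromrep rep x + fromrep rep y"
proof -
  have "rep (fromrep rep x + fromrep rep y) = x + y"
    using assms by (simp add: rep_add rep_fromrep)
  then show ?thesis
    by (metis fromrep_rep)
qed

lemma fromrep_eqD:
  "fromrep rep x = fromrep rep y \<Longrightarrow> x \<in> carrier_vec h \<Longrightarrow> y \<in> carrier_vec h \<Longrightarrow> x = y"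
  by (metis rep_fromrep)

lemma rep_0: "rep 0 = 0\<^sub>v h"
proof -
  have "rep 0 + rep 0 = rep 0"
    by (simp flip: rep_add)
  then show ?thesis
    using add_self_bit_vec[OF rep_carrier[of 0]] by simp
qed

text \<open>XOR of a string with itself vanishes, and \<open>rep\<close> carries this over to the
  field; the root count for shifted polynomials depends on it.\<close>

lemma char_two: "(1 :: 'f) + 1 = 0"
proof -
  have "rep (1 + 1) = rep 0"
    using add_self_bit_vec[OF rep_carrier[of 1]] by (simp only: rep_add rep_0)
  then show ?thesis
    by simp
qed

lemma card_field: "card (UNIV :: 'f set) = 2 ^ h"
  using bij_betw_same_card[OF rep_bij] by (simp add: card_carrier_vec_bit h_def)

lemma finite_field: "finite (UNIV :: 'f set)"
  by (rule card_ge_0_finite) (simp add: card_field)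

text \<open>A field has \<open>0 \<noteq> 1\<close>, so its elements cannot all be the empty string.
  This excludes \<open>k \<ge> n\<close> and makes divisions by \<open>n - k\<close> and
  \<open>h\<close> meaningful.\<close>

lemma h_pos: "h > 0"
proof (rule ccontr)
  assume "\<not> h > 0"
  then have "card (UNIV :: 'f set) = 1"
    by (simp add: card_field)
  then obtain x where "(UNIV :: 'f set) = {x}"
    using card_1_singletonE by blast
  then have "(0 :: 'f) = 1"
    by (metis UNIV_I singletonD)
  then show False
    by simp
qed

lemma k_less_n: "k < n" and n_minus_k: "n - k = 2 * h"
  using h_pos n'_even unfolding h_def by auto

lemma Suc_h_diff: "Suc h - (v + 1) = l" "v \<le> h" "l + v = h"
  using v_nonneg by (auto simp: v_def h_def)

lemma S_carrier [simp]: "w \<in> carrier_vec n \<Longrightarrow> S *\<^sub>v w \<in> carrier_vec k"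
  using S_dim by (rule mult_mat_vec_carrier)

lemma Sp_carrier [simp]: "w \<in> carrier_vec n \<Longrightarrow> Sp *\<^sub>v w \<in> carrier_vec (2 * h)"
  using mult_mat_vec_carrier[OF Sp_dim] n_minus_k by simp

lemma S_add: "w \<in> carrier_vec n \<Longrightarrow> w' \<in> carrier_vec n \<Longrightarrow> S *\<^sub>v (w + w') = S *\<^sub>v w + S *\<^sub>v w'"
  using S_dim by (rule mult_add_distrib_mat_vec)

lemma Sp_add: "w \<in> carrier_vec n \<Longrightarrow> w' \<in> carrier_vec n \<Longrightarrow> Sp *\<^sub>v (w + w') = Sp *\<^sub>v w + Sp *\<^sub>v w'"
  using Sp_dim by (rule mult_add_distrib_mat_vec)

lemma substr_halves_carrier [simp]:
  "substr x (Suc 0) h \<in> carrier_vec h" "substr x (Suc h) (2 * h) \<in> carrier_vec h"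
  using substr_carrier[of x "Suc 0" h] substr_carrier[of x "Suc h" "2 * h"] by simp_all

lemma half_a_add: "w \<in> carrier_vec n \<Longrightarrow> w' \<in> carrier_vec n \<Longrightarrow> half_a (w + w') = half_a w + half_a w'"
  unfolding half_a_def by (simp add: Sp_add substr_add[where N = "2 * h"] fromrep_add)

lemma half_b_add: "w \<in> carrier_vec n \<Longrightarrow> w' \<in> carrier_vec n \<Longrightarrow> half_b (w + w') = half_b w + half_b w'"
  unfolding half_b_def n_minus_k by (simp add: Sp_add substr_add[where N = "2 * h"] fromrep_add)

text \<open>The stacked matrix has full rank, hence nonzero determinant, and sends
  \<open>w + w'\<close> to zero. So \<open>w + w'\<close> vanishes, which over GF(2) means
  equality.\<close>

lemma eq_if_syndrome_halves_eq:
  assumes w: "w \<in> carrier_vec n" "w' \<in> carrier_vec n"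
    and S_eq: "S *\<^sub>v w = S *\<^sub>v w'" and halves: "half_a w = half_a w'" "half_b w = half_b w'"
  shows "w = w'"
proof -
  let ?M = "S @\<^sub>r Sp"
  have "Sp *\<^sub>v w = Sp *\<^sub>v w'"
  proof (rule eq_if_substr_eq)
    show "substr (Sp *\<^sub>v w) 1 h = substr (Sp *\<^sub>v w') 1 h"
      using halves(1) by (intro fromrep_eqD) (auto simp: half_a_def)
    show "substr (Sp *\<^sub>v w) (h + 1) (2 * h) = substr (Sp *\<^sub>v w') (h + 1) (2 * h)"
      using halves(2) by (intro fromrep_eqD) (auto simp: half_b_def n_minus_k)
  qed (use w in auto)
  then have "S *\<^sub>v (w + w') = 0\<^sub>v k" "Sp *\<^sub>v (w + w') = 0\<^sub>v (n - k)"
    using w S_eq by (simp_all add: S_add Sp_add add_self_bit_vec[of _ k] add_self_bit_vec[of _ "2 * h"] n_minus_k)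
  then have "?M *\<^sub>v (w + w') = 0\<^sub>v k @\<^sub>v 0\<^sub>v (n - k)"
    using w mat_mult_append[OF S_dim Sp_dim, of "w + w'"] by simp
  also have "\<dots> = 0\<^sub>v n"
    using k_less_n by (intro eq_vecI) auto
  finally have zero: "?M *\<^sub>v (w + w') = 0\<^sub>v n" .
  have M: "?M \<in> carrier_mat n n"
    using carrier_append_rows[OF S_dim Sp_dim] k_less_n by simp
  then have "Determinant.det ?M \<noteq> 0"
    using vec_space.det_rank_iff stack_rank by blast
  moreover have "w + w' \<in> carrier_vec n"
    using w by simp
  ultimately have "w + w' = 0\<^sub>v n"
    using det_0_iff_vec_prod_zero_field[OF M] zero by blast
  then show ?thesis
    using w add_eq_zero_bit_vec by blast
qed

text \<open>The factor 2 in \<open>L\<close> makes up for the halving of \<open>n - k\<close>, so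
  \<open>L * h\<close> is the rounded-up quotient times \<open>n - k\<close>. Padding therefore
  never truncates a syndrome.\<close>

lemma k_le_L_h: "k \<le> L * h"
proof -
  have "real k = real k / real (n - k) * real (n - k)"
    using k_less_n by simp
  also have "\<dots> \<le> real (nat \<lceil>real k / real (n - k)\<rceil>) * real (n - k)"
    by (intro mult_right_mono) (auto simp: of_nat_nat real_nat_ceiling_ge)
  also have "\<dots> = real (L * h)"
    unfolding L_def Lpar_def n_minus_k by simp
  finally show ?thesis
    by (simp only: of_nat_le_iff)
qed

lemma eq_if_coeff_s_eq:
  assumes s: "s \<in> carrier_vec k" "s' \<in> carrier_vec k"
    and coeff_eq: "\<And>j. j < L \<Longrightarrow> coeff_s rep h L s j = coeff_s rep h L s' j"
  shows "s = s'"
proof (rule eq_vecI)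
  fix p assume "p < dim_vec s'"
  then have p: "p < k" "p < L * h"
    using s k_le_L_h by auto
  \<comment> \<open>Coefficients are numbered from the right: bit \<open>p\<close> lies in block
    \<open>p div h\<close> from the left, at position \<open>p mod h\<close>, and that block encodes
    coefficient \<open>L - 1 - p div h\<close>.\<close>
  define j where "j = L - 1 - p div h"
  have div: "p div h < L"
    using p h_pos by (simp add: less_mult_imp_div_less)
  have j: "j < L" "L - 1 - j = p div h" "L - j = Suc (p div h)"
    using div by (auto simp: j_def)
  have len: "Suc (Suc (p div h) * h) - (p div h * h + 1) = h"
    by simp
  have "substr (pad (L * h) s) (p div h * h + 1) (Suc (p div h) * h)
      = substr (pad (L * h) s') (p div h * h + 1) (Suc (p div h) * h)"
    using coeff_eq[OF j(1)] unfolding coeff_s_def j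
    by (rule fromrep_eqD) (metis len substr_carrier)+
  from arg_cong[OF this, of "\<lambda>x. x $ (p mod h)"]
  have "pad (L * h) s $ (p div h * h + p mod h) = pad (L * h) s' $ (p div h * h + p mod h)"
    using h_pos by (simp add: substr_def)
  then have "pad (L * h) s $ p = pad (L * h) s' $ p"
    by (simp only: div_mult_mod_eq)
  then show "s $ p = s' $ p"
    using p s by (simp add: pad_def)
qed (use s in simp)

section \<open>Universality of the hash\<close>

lemma hash_carrier [simp]: "hash i w \<in> carrier_vec h"
  by (simp add: hash_def)

lemma hash_eq_iff:
  "hash i w = hash i' w' \<longleftrightarrow>
   substr (hash i w) (v + 1) h = substr (hash i' w') (v + 1) h \<and> substr (hash i w) 1 v = substr (hash i' w') 1 v"
  using eq_if_substr_eq[of "hash i w" h "hash i' w'" v] Suc_h_diff(2) by auto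

text \<open>Subtracting the collision equations for two keys leaves
  \<open>(i - i') * (half_a w' - half_a w) = 0\<close>. Two distinct colliding keys thus force equal
  first halves, then equal second halves, and with equal syndromes equal strings.\<close>

lemma hash_universal:
  assumes w: "w \<in> carrier_vec n" "w' \<in> carrier_vec n" "w \<noteq> w'" and S_eq: "S *\<^sub>v w = S *\<^sub>v w'"
  shows "card {i. hash i w' = hash i w} \<le> 1"
proof -
  have cancel: "(i - i') * (a' - a) = 0"
    if "c' + i * a' + b' = c + i * a + b" "c' + i' * a' + b' = c + i' * a + b" for i i' a a' b b' c c' :: 'f
  proof -
    have "(i - i') * (a' - a) = (c' + i * a' + b' - (c + i * a + b)) - (c' + i' * a' + b' - (c + i' * a + b))"
      by (simp add: algebra_simps)
    then show ?thesis
      using that by simp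
  qed
  have "i = i'" if "hash i w' = hash i w" "hash i' w' = hash i' w" for i i'
  proof (rule ccontr)
    assume "i \<noteq> i'"
    have "(i - i') * (half_a w' - half_a w) = 0"
      using that unfolding hash_def rep_eq_iff fpoly_def S_eq by (rule cancel)
    then have "half_a w' = half_a w"
      using \<open>i \<noteq> i'\<close> by simp
    moreover from this have "half_b w' = half_b w"
      using that(1) by (simp add: hash_def S_eq)
    ultimately show False
      using eq_if_syndrome_halves_eq[OF w(1,2) S_eq] w(3) by simp
  qed
  then show ?thesis
    using finite_subset[OF subset_UNIV finite_field]
    by (simp add: card_le_Suc0_iff_eq)
qed

section \<open>Acceptance, correctness and the recovered string\<close>

lemma Rep_acceptsD:
  assumes "Rep_c n k S Sp SRec rep l t w' (c', i', \<nu>') \<noteq> None" "w' \<in> carrier_vec n"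
  obtains ws where "c' \<in> carrier_vec k" "ws \<in> carrier_vec n" "dis ws w' \<le> t" "S *\<^sub>v ws = c'"
    "\<nu>' = substr (hash i' ws) 1 v"
proof
  show c': "c' \<in> carrier_vec k"
    using assms by (auto simp: Rep_c_def Let_def split: if_splits)
  show "SRec w' c' \<in> carrier_vec n"
    using c' assms(2) by (rule SRec_carrier[rotated])
  show "dis (SRec w' c') w' \<le> t" "S *\<^sub>v SRec w' c' = c'" "\<nu>' = substr (hash i' (SRec w' c')) 1 v"
    using assms(1) by (auto simp: Rep_c_def Let_def hash_def half_a_def half_b_def h_def v_def L_def not_less
        split: if_splits)
qed

lemma Rep_correct:
  assumes "w \<in> carrier_vec n" "w' \<in> carrier_vec n" "dis w w' \<le> t"
  shows "Rep_c n k S Sp SRec rep l t w' (S *\<^sub>v w, i, substr (hash i w) 1 v) = Some (substr (hash i w) (v + 1) h)"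
  using assms SRec_correct[OF assms]
  by (simp add: Rep_c_def Let_def hash_def half_a_def half_b_def h_def v_def L_def)

text \<open>An error \<open>e\<close> of weight at most \<open>t\<close> is recovered from its syndrome as \<open>SRec 0 (S e)\<close>. By
  linearity, the string recovered from \<open>w + \<Delta>\<close> and a forged syndrome \<open>c'\<close> therefore differs from \<open>w\<close> by
  an offset that depends on \<open>w\<close> only through its syndrome \<open>c\<close>.\<close>

definition offset where
  "offset c c' \<Delta> = \<Delta> + SRec (0\<^sub>v n) (c' + c + S *\<^sub>v \<Delta>)"

lemma offset_carrier:
  "c \<in> carrier_vec k \<Longrightarrow> c' \<in> carrier_vec k \<Longrightarrow> \<Delta> \<in> carrier_vec n \<Longrightarrow> offset c c' \<Delta> \<in> carrier_vec n"
  by (simp add: offset_def SRec_carrier)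

lemma SRec_zero:
  assumes "e \<in> carrier_vec n" "dis (0\<^sub>v n) e \<le> t"
  shows "SRec (0\<^sub>v n) (S *\<^sub>v e) = e"
  using assms SRec_correct[of e "0\<^sub>v n"] dis_commute[of "0\<^sub>v n" n e] by simp

text \<open>The syndrome handed to \<open>SRec\<close> in \<open>offset\<close> sums to that of
  \<open>ws + w'\<close>, whose weight is at most \<open>t\<close>. Decoding therefore returns
  \<open>ws + w'\<close>, and the copies of \<open>w'\<close> cancel.\<close>

lemma add_offset_eq:
  assumes w: "w \<in> carrier_vec n" "w' \<in> carrier_vec n" "ws \<in> carrier_vec n" and ws: "dis ws w' \<le> t"
  shows "w + offset (S *\<^sub>v w) (S *\<^sub>v ws) (w + w') = ws"
proof -
  have "S *\<^sub>v ws + S *\<^sub>v w + S *\<^sub>v (w + w') = S *\<^sub>v ws + (S *\<^sub>v w + (S *\<^sub>v w + S *\<^sub>v w'))"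
    using w by (simp add: S_add assoc_add_vec[where n = k])
  also have "\<dots> = S *\<^sub>v (ws + w')"
    using w by (simp add: S_add add_cancel_bit_vec[where n = k])
  finally have "offset (S *\<^sub>v w) (S *\<^sub>v ws) (w + w') = (w + w') + (ws + w')"
    using w ws SRec_zero[of "ws + w'"] by (simp add: offset_def dis_zero_add)
  also have "\<dots> = w + (w' + (w' + ws))"
    using w by (simp add: assoc_add_vec[where n = n] comm_add_vec[of ws n w'])
  also have "\<dots> = w + ws"
    using w by (simp add: add_cancel_bit_vec[where n = n])
  finally show ?thesis
    using w by (simp add: add_cancel_bit_vec[where n = n])
qed

text \<open>With an unchanged syndrome, decoding returns \<open>\<Delta>\<close> itself, which
  cancels. A forgery that keeps the syndrome is thus checked against the original string.\<close>

lemma offset_same: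
  assumes "c \<in> carrier_vec k" "\<Delta> \<in> carrier_vec n" "dis (0\<^sub>v n) \<Delta> \<le> t"
  shows "offset c c \<Delta> = 0\<^sub>v n"
  using assms SRec_zero[of \<Delta>] by (simp add: offset_def add_self_bit_vec[where n = k] add_self_bit_vec[where n = n])

section \<open>Counting forgeable strings\<close>

lemma card_prefix_le: "card {z. substr (rep z) 1 v = \<nu>} \<le> 2 ^ l"
proof -
  have "card {z. substr (rep z) 1 v = \<nu>} \<le> card (carrier_vec l :: bits set)"
  proof (rule card_inj_on_le)
    show "inj_on (\<lambda>z. substr (rep z) (v + 1) h) {z. substr (rep z) 1 v = \<nu>}"
    proof (rule inj_onI)
      fix z z'
      assume "z \<in> {z. substr (rep z) 1 v = \<nu>}" "z' \<in> {z. substr (rep z) 1 v = \<nu>}"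
        and "substr (rep z) (v + 1) h = substr (rep z') (v + 1) h"
      then have "rep z = rep z'"
        by (intro eq_if_substr_eq[OF rep_carrier rep_carrier Suc_h_diff(2)]) auto
      then show "z = z'"
        by simp
    qed
    show "(\<lambda>z. substr (rep z) (v + 1) h) ` {z. substr (rep z) 1 v = \<nu>} \<subseteq> carrier_vec l"
      using substr_carrier[of _ "v + 1" h] Suc_h_diff(1) by auto
  qed simp
  then show ?thesis
    by (simp add: card_carrier_vec_bit)
qed

text \<open>For a fixed error pattern, \<open>\<gamma>\<close> is constant. The known hash ties
  \<open>half_b w\<close> to \<open>half_a w\<close>, so \<open>half_a w\<close> determines
  \<open>w\<close>; it must be a root of one of at most \<open>2 ^ l\<close> equations, one for each
  hash value of \<open>w + \<gamma>\<close> with the forged prefix.\<close>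

lemma card_forgeable_at_le:
  fixes \<rho> :: bits
  assumes c: "c \<in> carrier_vec k" "c' \<in> carrier_vec k"
    and \<Delta>: "\<Delta> \<in> carrier_vec n" "dis (0\<^sub>v n) \<Delta> \<le> t"
    and ne: "(c', i', \<nu>') \<noteq> (c, i, \<nu>)"
  defines "\<gamma> \<equiv> offset c c' \<Delta>"
  defines "Bad \<equiv> {w \<in> carrier_vec n. S *\<^sub>v w = c \<and> substr (hash i w) (v + 1) h = \<rho> \<and> substr (hash i w) 1 v = \<nu> \<and>
      S *\<^sub>v (w + \<gamma>) = c' \<and> substr (hash i' (w + \<gamma>)) 1 v = \<nu>'}"
  shows "card Bad \<le> (L + 2) * 2 ^ l"
proof (cases "Bad = {}")
  case False
  then obtain w0 where w0: "w0 \<in> Bad"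
    by blast
  have \<gamma>: "\<gamma> \<in> carrier_vec n"
    using c \<Delta> by (simp add: \<gamma>_def offset_carrier)
  \<comment> \<open>Otherwise the syndromes agree, hence \<open>\<gamma>\<close> is zero, and the
    keys agree too. The forged prefix would then be that of \<open>w0\<close> itself and the forgery
    would be the original helper string.\<close>
  have distinct: "half_a \<gamma> \<noteq> 0 \<or> (\<exists>j<L. coeff_s rep h L c j \<noteq> coeff_s rep h L c' j) \<or> i \<noteq> i'"
  proof (rule ccontr)
    assume "\<not> ?thesis"
    then have "c = c'" "i = i'"
      using eq_if_coeff_s_eq[OF c] by auto
    then have "w0 + \<gamma> = w0"
      using w0 offset_same[OF c(1) \<Delta>] by (simp add: \<gamma>_def Bad_def)
    then show False
      using w0 ne \<open>c = c'\<close> \<open>i = i'\<close> by (auto simp: Bad_def)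
  qed
  define F where "F c i x = fpoly rep h L c i x" for c i x
  define roots where "roots z = {x. F c' i' (x + half_a \<gamma>) - F c i x = z}" for z
  have roots: "finite (roots z)" "card (roots z) \<le> L + 2" for z
    using card_shifted_difference_roots[OF char_two _ distinct, of z]
    unfolding roots_def F_def fpoly_def by (simp_all add: L_def Lpar_def)
  define y0 where "y0 = fromrep rep (hash i w0)"
  have hash_w0: "hash i w = hash i w0" if "w \<in> Bad" for w
    using that w0 hash_eq_iff[of i w i w0] by (simp add: Bad_def)
  have half_b: "half_b w = y0 - F c i (half_a w)" if "w \<in> Bad" for w
  proof -
    have "y0 = fromrep rep (hash i w)"
      using hash_w0[OF that] by (simp add: y0_def)
    also have "\<dots> = F c i (half_a w) + half_b w"
      using that by (simp add: hash_def Bad_def F_def)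
    finally have "y0 = F c i (half_a w) + half_b w" .
    then show ?thesis
      by simp
  qed
  define Z where "Z = {z. substr (rep z) 1 v = \<nu>'}"
  \<comment> \<open>The first component is the field element encoded by the hash of
    \<open>w + \<gamma>\<close>. Subtracting \<open>y0\<close> and \<open>half_b \<gamma>\<close>
    eliminates \<open>half_b w\<close> and leaves the polynomial difference in
    \<open>roots\<close>.\<close>
  define g where "g w = (F c' i' (half_a w + half_a \<gamma>) + half_b w + half_b \<gamma>, half_a w)" for w
  have "card Bad \<le> card (Sigma Z (\<lambda>z. roots (z - y0 - half_b \<gamma>)))"
  proof (rule card_inj_on_le)
    show "inj_on g Bad"
    proof (rule inj_onI)
      fix w w' assume w: "w \<in> Bad" "w' \<in> Bad" and "g w = g w'"
      then have "half_a w = half_a w'"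
        by (simp add: g_def)
      moreover from this have "half_b w = half_b w'"
        using half_b w by simp
      ultimately show "w = w'"
        using w eq_if_syndrome_halves_eq[of w w'] by (auto simp: Bad_def)
    qed
    show "g ` Bad \<subseteq> Sigma Z (\<lambda>z. roots (z - y0 - half_b \<gamma>))"
    proof (rule image_subsetI)
      fix w assume w: "w \<in> Bad"
      have "hash i' (w + \<gamma>) = rep (fst (g w))"
        using w \<gamma> by (simp add: hash_def g_def Bad_def F_def half_a_add half_b_add add.assoc)
      then have "fst (g w) \<in> Z"
        using w by (simp add: Z_def Bad_def)
      then show "g w \<in> Sigma Z (\<lambda>z. roots (z - y0 - half_b \<gamma>))"
        using half_b[OF w] by (simp add: g_def roots_def)
    qed
    show "finite (Sigma Z (\<lambda>z. roots (z - y0 - half_b \<gamma>)))"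
      using roots finite_subset[OF subset_UNIV finite_field] by (intro finite_SigmaI)
  qed
  also have "\<dots> = (\<Sum>z\<in>Z. card (roots (z - y0 - half_b \<gamma>)))"
    using roots finite_subset[OF subset_UNIV finite_field] by (intro card_SigmaI) auto
  also have "\<dots> \<le> card Z * (L + 2)"
    using roots by (intro sum_bounded_above[where 'a = nat, simplified])
  also have "\<dots> \<le> 2 ^ l * (L + 2)"
    unfolding Z_def by (intro mult_right_mono card_prefix_le) simp
  finally show ?thesis
    by (simp add: mult.commute)
qed simp

text \<open>Encoding a pair as its error pattern \<open>w + w'\<close> together with
  \<open>w\<close> splits the count into patterns from the ball and the strings counted by
  \<open>card_forgeable_at_le\<close>. Forged syndromes of the wrong length are never
  accepted.\<close>

lemma card_forgeable_le:
  assumes WW: "\<And>w w'. (w, w') \<in> ZZ \<Longrightarrow> w \<in> carrier_vec n \<and> w' \<in> carrier_vec n \<and> dis w w' \<le> t"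
    and c: "c \<in> carrier_vec k" and ne: "P' \<noteq> (c, i, \<nu>)"
  shows "card {z \<in> ZZ. S *\<^sub>v fst z = c \<and> substr (hash i (fst z)) (v + 1) h = \<rho> \<and>
      substr (hash i (fst z)) 1 v = \<nu> \<and> Rep_c n k S Sp SRec rep l t (snd z) P' \<noteq> None}
    \<le> ball_size n t * ((L + 2) * 2 ^ l)" (is "card ?X \<le> _")
proof -
  obtain c' i' \<nu>' where P': "P' = (c', i', \<nu>')"
    by (cases P')
  show ?thesis
  proof (cases "c' \<in> carrier_vec k")
    case True
    define Ball where "Ball = {y \<in> carrier_vec n. dis (0\<^sub>v n) y \<le> t}"
    define Bad where "Bad \<Delta> = {w \<in> carrier_vec n. S *\<^sub>v w = c \<and> substr (hash i w) (v + 1) h = \<rho> \<and>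
        substr (hash i w) 1 v = \<nu> \<and> S *\<^sub>v (w + offset c c' \<Delta>) = c' \<and>
        substr (hash i' (w + offset c c' \<Delta>)) 1 v = \<nu>'}" for \<Delta>
    have fin: "finite Ball" "finite (Bad \<Delta>)" for \<Delta>
      by (auto simp: Ball_def Bad_def)
    have "card ?X \<le> card (Sigma Ball Bad)"
    proof (rule card_inj_on_le)
      show "inj_on (\<lambda>(w, w'). (w + w', w)) ?X"
      proof (rule inj_onI)
        fix y z
        assume "y \<in> ?X" "z \<in> ?X" "(case y of (w, w') \<Rightarrow> (w + w', w)) = (case z of (w, w') \<Rightarrow> (w + w', w))"
        then obtain w w1' w2' where yz: "y = (w, w1')" "z = (w, w2')" "w + w1' = w + w2'"
            "(w, w1') \<in> ZZ" "(w, w2') \<in> ZZ"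
          by (auto split: prod.splits)
        then have "w1' = w2'"
          using WW add_cancel_bit_vec by metis
        then show "y = z"
          using yz by simp
      qed
      show "(\<lambda>(w, w'). (w + w', w)) ` ?X \<subseteq> Sigma Ball Bad"
      proof (rule image_subsetI)
        fix z assume z: "z \<in> ?X"
        obtain w w' where [simp]: "z = (w, w')"
          by (cases z)
        have w: "w \<in> carrier_vec n" "w' \<in> carrier_vec n" "dis w w' \<le> t"
          using z WW by auto
        obtain ws where ws: "ws \<in> carrier_vec n" "dis ws w' \<le> t" "S *\<^sub>v ws = c'" "\<nu>' = substr (hash i' ws) 1 v"
          using z P' by (auto intro: Rep_acceptsD[OF _ w(2), of c' i' \<nu>'])
        \<comment> \<open>Acceptance at \<open>w'\<close> becomes a condition on \<open>w\<close>
          and the error pattern alone.\<close>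
        have "w + offset c c' (w + w') = ws"
          using add_offset_eq[OF w(1,2) ws(1,2)] z ws(3) by simp
        then show "(case z of (w, w') \<Rightarrow> (w + w', w)) \<in> Sigma Ball Bad"
          using z w ws by (simp add: Ball_def Bad_def dis_zero_add)
      qed
      show "finite (Sigma Ball Bad)"
        using fin by blast
    qed
    also have "\<dots> = (\<Sum>\<Delta>\<in>Ball. card (Bad \<Delta>))"
      using fin by (intro card_SigmaI) auto
    also have "\<dots> \<le> card Ball * ((L + 2) * 2 ^ l)"
      using card_forgeable_at_le[OF c True] ne P'
      by (intro sum_bounded_above[where 'a = nat, simplified]) (auto simp: Ball_def Bad_def)
    finally show ?thesis
      by (simp add: Ball_def ball_size_def)
  next
    case False
    then have "?X = {}"
      by (auto simp: P' Rep_c_def)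
    then show ?thesis
      by (simp only: card.empty le0)
  qed
qed

section \<open>The two security bounds\<close>

lemma extractor_stat_dist_le:
  assumes W: "set_pmf W \<subseteq> carrier_vec n" "min_entropy W \<ge> m"
  shows "stat_dist (bind_pmf W (Gen_c n k S Sp rep l))
      (pair_pmf (unif l) (map_pmf snd (bind_pmf W (Gen_c n k S Sp rep l))))
    \<le> sqrt (2 powr (real k + real h - m))"
proof -
  have "stat_dist (bind_pmf W (Gen_c n k S Sp rep l))
      (pair_pmf (unif l) (map_pmf snd (bind_pmf W (Gen_c n k S Sp rep l))))
    \<le> sqrt (card (carrier_vec k :: bits set) * (card (carrier_vec l :: bits set) * card (carrier_vec v :: bits set))
        * 2 powr (- m))"
    unfolding unif_def
  proof (rule stat_dist_extractor_le)
    fix w w' :: bits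
    assume w: "w \<in> carrier_vec n" "w' \<in> carrier_vec n" "w \<noteq> w'" "S *\<^sub>v w = S *\<^sub>v w'"
    \<comment> \<open>Extracted and published parts together take \<open>2 ^ h\<close> values, as
      many as there are keys, so universality allows exactly one colliding key.\<close>
    have "card (carrier_vec l :: bits set) * card (carrier_vec v :: bits set) *
        card {i \<in> UNIV. substr (hash i w') (v + 1) h = substr (hash i w) (v + 1) h \<and>
          substr (hash i w') 1 v = substr (hash i w) 1 v}
      = 2 ^ h * card {i. hash i w' = hash i w}"
      using Suc_h_diff(3) by (simp add: card_carrier_vec_bit hash_eq_iff flip: power_add)
    also have "\<dots> \<le> card (UNIV :: 'f set)"
      using hash_universal[OF w] by (simp add: card_field)
    finally show "card (carrier_vec l :: bits set) * card (carrier_vec v :: bits set) *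
        card {i \<in> UNIV. substr (hash i w') (v + 1) h = substr (hash i w) (v + 1) h \<and>
          substr (hash i w') 1 v = substr (hash i w) 1 v} \<le> card (UNIV :: 'f set)" .
  next
    fix w show "pmf W w \<le> 2 powr (- m)"
      using W(2) by (rule min_entropy_imp_pmf_le)
  next
    fix i w show "substr (hash i w) (v + 1) h \<in> carrier_vec l"
      using substr_carrier[of "hash i w" "v + 1" h] Suc_h_diff(1) by simp
  next
    fix i w show "substr (hash i w) 1 v \<in> carrier_vec v"
      using substr_carrier[of "hash i w" 1 v] by simp
  qed (use W finite_field in \<open>auto simp: Gen_eq\<close>)
  also have "\<dots> = sqrt (2 powr (real k + real h - m))"
    using Suc_h_diff(3)
    by (simp add: card_carrier_vec_bit powr_add powr_diff powr_minus powr_realpow divide_inverse flip: power_add)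
  finally show ?thesis .
qed

lemma forgery_prob_le:
  assumes "tm_pair n t m WW"
  shows "measure_pmf.prob
      (bind_pmf WW (\<lambda>(w, w'). bind_pmf (Gen_c n k S Sp rep l w) (\<lambda>(R, P).
         bind_pmf (A R P) (\<lambda>P'. return_pmf (P, P', w')))))
      {(P, P', w'). P' \<noteq> P \<and> Rep_c n k S Sp SRec rep l t w' P' \<noteq> None}
    \<le> 2 ^ (k + h) * (real (ball_size n t * ((L + 2) * 2 ^ l)) * 2 powr (- m))"
proof -
  have WW: "(w, w') \<in> set_pmf WW \<Longrightarrow> w \<in> carrier_vec n \<and> w' \<in> carrier_vec n \<and> dis w w' \<le> t" for w w'
    using assms by (auto simp: tm_pair_def)
  have "measure_pmf.prob
      (bind_pmf WW (\<lambda>(w, w'). bind_pmf (Gen_c n k S Sp rep l w) (\<lambda>(R, P).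
         bind_pmf (A R P) (\<lambda>P'. return_pmf (P, P', w')))))
      {(P, P', w'). P' \<noteq> P \<and> Rep_c n k S Sp SRec rep l t w' P' \<noteq> None}
    \<le> card (carrier_vec k :: bits set) * (card (carrier_vec l :: bits set) * card (carrier_vec v :: bits set))
      * (real (ball_size n t * ((L + 2) * 2 ^ l)) * 2 powr (- m))"
  proof (rule prob_forgery_le)
    show "finite (set_pmf WW)"
      using assms by (auto simp: tm_pair_def intro: finite_subset)
    fix z :: "bits \<times> bits"
    \<comment> \<open>Entropy is guaranteed for \<open>w\<close> only; a pair is at most as likely
      as its first component, however \<open>w'\<close> depends on it.\<close>
    have "measure_pmf.prob WW {z} \<le> measure_pmf.prob WW (fst -` {fst z})"
      by (intro measure_pmf.finite_measure_mono) auto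
    then have "pmf WW z \<le> pmf (map_pmf fst WW) (fst z)"
      by (simp add: pmf_map measure_pmf_single)
    also have "\<dots> \<le> 2 powr (- m)"
      using assms by (intro min_entropy_imp_pmf_le) (simp add: tm_pair_def)
    finally show "pmf WW z \<le> 2 powr (- m)" .
  next
    fix w w' i assume "(w, w') \<in> set_pmf WW"
    show "substr (hash i w) (v + 1) h \<in> carrier_vec l"
      using substr_carrier[of "hash i w" "v + 1" h] Suc_h_diff(1) by simp
  next
    fix w w' i assume "(w, w') \<in> set_pmf WW"
    show "substr (hash i w) 1 v \<in> carrier_vec v"
      using substr_carrier[of "hash i w" 1 v] by simp
  next
    fix i :: 'f and c \<rho> \<nu> :: bits and P'
    assume "c \<in> carrier_vec k" "P' \<noteq> (c, i, \<nu>)"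
    then show "card {z \<in> set_pmf WW. S *\<^sub>v fst z = c \<and> substr (hash i (fst z)) (v + 1) h = \<rho> \<and>
        substr (hash i (fst z)) 1 v = \<nu> \<and> Rep_c n k S Sp SRec rep l t (snd z) P' \<noteq> None}
      \<le> ball_size n t * ((L + 2) * 2 ^ l)"
      by (intro card_forgeable_le WW)
  qed (use WW finite_field in \<open>auto simp: Gen_eq\<close>)
  then show ?thesis
    using Suc_h_diff(3) by (simp add: card_carrier_vec_bit flip: power_add)
qed

end

text \<open>The centre lies in the ball. Positivity lets the ball size be recovered from its
  logarithm in the final calculation.\<close>

lemma ball_size_pos: "ball_size n t > 0"
proof -
  have "0\<^sub>v n \<in> {y \<in> carrier_vec n. dis (0\<^sub>v n) y \<le> t}"
    by (simp add: dis_def)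
  then show ?thesis
    unfolding ball_size_def by (subst card_gt_0_iff) (use finite_carrier_vec_bit in fastforce)
qed

theorem theorem2:
  fixes n k t l :: nat and m eps \<delta> :: real
    and S Sp :: "bit mat" and SRec :: "bits \<Rightarrow> bits \<Rightarrow> bits"
    and rep :: "'f::field \<Rightarrow> bits"
  assumes S_dim: "S \<in> carrier_mat k n"
    and S_rank: "vec_space.rank k S = k"
    and Sp_dim: "Sp \<in> carrier_mat (n - k) n"
    and stack_rank: "vec_space.rank n (S @\<^sub>r Sp) = n"
    and SRec_range: "\<forall>w'\<in>carrier_vec n. \<forall>s\<in>carrier_vec k. SRec w' s \<in> carrier_vec n"
    and sketch: "secure_sketch n (\<lambda>w. S *\<^sub>v w) SRec m (m - real k) t"
    and n'_even: "even (n - k)"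
    and rep_bij: "bij_betw rep UNIV (carrier_vec ((n - k) div 2))"
    and rep_add: "\<forall>x y. rep (x + y) = rep x + rep y"
    and eps_pos: "eps > 0"
    and delta_pos: "\<delta> > 0"
    and l_bound: "real l \<le> m - real n / 2 - real k - log 2 (real (ball_size n t))
                     - log 2 (2 * real_of_int \<lceil>real k / real (n - k)\<rceil> + 2) - log 2 (1 / \<delta>)"
    and m_bound: "m \<ge> (real n + real k) / 2 + 2 * log 2 (1 / eps)"
    and v_nonneg: "l \<le> (n - k) div 2"
  shows "fuzzy_extractor n (Gen_c n k S Sp rep l) (Rep_c n k S Sp SRec rep l t) m l t eps \<and>
         post_app_robust n (Gen_c n k S Sp rep l) (Rep_c n k S Sp SRec rep l t) t m \<delta>"
proof -
  interpret sketch_extractor n k t l S Sp SRec rep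
    using S_dim Sp_dim stack_rank SRec_range sketch n'_even rep_bij rep_add v_nonneg
    by unfold_locales (auto simp: secure_sketch_def)
  have h: "real h = (real n - real k) / 2"
    using arg_cong[OF n_minus_k, of real] k_less_n by (simp add: of_nat_diff)
  \<comment> \<open>Since \<open>k + h = (n + k) / 2\<close>, the bound on \<open>m\<close> limits
    exactly the exponent in \<open>extractor_stat_dist_le\<close>.\<close>
  have "real k + real h - m \<le> 2 * log 2 eps"
    using m_bound eps_pos by (simp add: h log_divide field_simps)
  then have "2 powr (real k + real h - m) \<le> 2 powr (2 * log 2 eps)"
    by simp
  also have "\<dots> = (2 powr log 2 eps) powr 2"
    by (simp add: powr_powr mult.commute)
  also have "\<dots> = eps\<^sup>2"
    using eps_pos by (simp add: powr_numeral)
  finally have eps: "sqrt (2 powr (real k + real h - m)) \<le> eps"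
    using eps_pos by (simp add: real_le_lsqrt)
  \<comment> \<open>The argument of the logarithm in \<open>l_bound\<close> is the root bound
    \<open>L + 2\<close>.\<close>
  have L: "2 * real_of_int \<lceil>real k / real (n - k)\<rceil> + 2 = real (L + 2)"
    by (simp add: L_def Lpar_def of_nat_nat)
  have B: "real (ball_size n t) > 0"
    using ball_size_pos by simp
  \<comment> \<open>All factors are positive, so the forgery bound is a single power of 2, and
    \<open>l_bound\<close> compares its exponent with \<open>log 2 \<delta>\<close>.\<close>
  have "2 ^ (k + h) * (real (ball_size n t * ((L + 2) * 2 ^ l)) * 2 powr (- m))
      = 2 powr (real k + real h + log 2 (ball_size n t) + log 2 (real (L + 2)) + real l - m)"
    using B by (simp add: powr_add powr_diff powr_minus powr_realpow power_add divide_inverse distrib_right)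
  also have "\<dots> \<le> 2 powr log 2 \<delta>"
  proof (intro powr_mono)
    show "real k + real h + log 2 (ball_size n t) + log 2 (real (L + 2)) + real l - m \<le> log 2 \<delta>"
      using l_bound delta_pos unfolding L by (simp add: h log_divide field_simps)
  qed simp
  also have "\<dots> = \<delta>"
    using delta_pos by simp
  finally have delta: "2 ^ (k + h) * (real (ball_size n t * ((L + 2) * 2 ^ l)) * 2 powr (- m)) \<le> \<delta>" .
  have "fuzzy_extractor n (Gen_c n k S Sp rep l) (Rep_c n k S Sp SRec rep l t) m l t eps"
    unfolding fuzzy_extractor_def
  proof (intro conjI ballI allI impI)
    fix w :: bits and x assume w: "w \<in> carrier_vec n" and "x \<in> set_pmf (Gen_c n k S Sp rep l w)"
    then show "case x of (R, P) \<Rightarrow> R \<in> carrier_vec l"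
      using substr_carrier[of _ "v + 1" h] Suc_h_diff(1) by (auto simp: Gen_eq finite_field)
  next
    fix w w' :: bits and x
    assume "w \<in> carrier_vec n" "w' \<in> carrier_vec n" "dis w w' \<le> t" "x \<in> set_pmf (Gen_c n k S Sp rep l w)"
    then show "case x of (R, P) \<Rightarrow> Rep_c n k S Sp SRec rep l t w' P = Some R"
      using Rep_correct by (auto simp: Gen_eq finite_field)
  next
    fix W :: "bits pmf" assume "set_pmf W \<subseteq> carrier_vec n" "m \<le> min_entropy W"
    then show "stat_dist (bind_pmf W (Gen_c n k S Sp rep l))
        (pair_pmf (unif l) (map_pmf snd (bind_pmf W (Gen_c n k S Sp rep l)))) \<le> eps"
      using extractor_stat_dist_le eps order_trans by blast
  qed
  moreover have "post_app_robust n (Gen_c n k S Sp rep l) (Rep_c n k S Sp SRec rep l t) t m \<delta>"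
    unfolding post_app_robust_def using forgery_prob_le delta order_trans by blast
  ultimately show ?thesis ..
qed

end
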